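(* Let $f,g$ be non-negative integers. Then in $M^{(f,g)}$, \[\sum_{\mu\in\mathcal P_{f,g}}t_\mu m=\sum_{\lambda\in\mathcal P_{f,g}}F(\lambda)\,s_\lambda m.\]
   Context: $\mathbb F$ is any field, $k=f+g$, $\mathfrak S_k$ has Coxeter generators $t_i=(i\ i{+}1)$ and $s_i=t_i-1\in\mathbb F\mathfrak S_k$. $M^{(f,g)}=\langle m\mid t_im=m\ (i\ne f)\rangle$ as an $\mathbb F\mathfrak S_k$-module. $\mathcal P_{f,g}$ is the set of partitions with at most $g$ nonzero parts, all at most $f$. For $\lambda\in\mathcal P_{f,g}$, $t_\lambda=\prod_{r=1}^{g}(t_{\lambda_r+g-r+1}t_{\lambda_r+g-r+2}\cdots t_{f+g-r})$ with $r=1$ leftmost (a factor is empty if $\lambda_r=f$), and $s_\lambda$ is the same formula with $t_i$ replaced by $s_i$. The function $F$ on partitions is defined recursively: $F(\varnothing)=1$; for $\lambda\ne\varnothing$ choose a node $(a,b)$ of $\lambda$ (i.e. $b\le\lambda_a$) with $a+b$ maximal, and set $F(\lambda)=\binom{a+b}{a}F((\lambda_{a+1},\lambda_{a+2},\dots))\,F((\max\{\lambda_1-b,0\},\max\{\lambda_2-b,0\},\dots))$; this does not depend on the choice of $(a,b)$. The integer $F(\lambda)$ is regarded as an element of $\mathbb F$. *)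

theory Defs
  imports Main HOL.Modules "HOL-Combinatorics.Permutations" "HOL-Combinatorics.Transposition"
begin

text \<open>A partition with at most g nonzero parts, all at most f, is represented by the
  list [lambda_1, ..., lambda_g] of length exactly g (padded with zeros), weakly decreasing.\<close>

definition Pfg :: "nat \<Rightarrow> nat \<Rightarrow> nat list set" where
  "Pfg f g = {xs. length xs = g \<and> sorted_wrt (\<ge>) xs \<and> (\<forall>x\<in>set xs. x \<le> f)}"

text \<open>The sequence of generator indices, read left to right, of
  prod_{r=1}^{g} (t_{lambda_r+g-r+1} t_{lambda_r+g-r+2} ... t_{f+g-r}).\<close>

definition tword :: "nat \<Rightarrow> nat \<Rightarrow> nat list \<Rightarrow> nat list" where
  "tword f g lam = concat (map (\<lambda>r. [lam ! (r - 1) + g - r + 1 ..< f + g - r + 1]) [1..<g + 1])"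

definition tgen :: "nat \<Rightarrow> nat \<Rightarrow> nat" where
  "tgen i = transpose i (Suc i)"

definition t_act :: "((nat \<Rightarrow> nat) \<Rightarrow> 'b \<Rightarrow> 'b) \<Rightarrow> nat list \<Rightarrow> 'b \<Rightarrow> 'b" where
  "t_act act w v = foldr (\<lambda>i x. act (tgen i) x) w v"

definition s_act :: "((nat \<Rightarrow> nat) \<Rightarrow> 'b::ab_group_add \<Rightarrow> 'b) \<Rightarrow> nat list \<Rightarrow> 'b \<Rightarrow> 'b" where
  "s_act act w v = foldr (\<lambda>i x. act (tgen i) x - x) w v"

definition Sk_module :: "('a::field \<Rightarrow> 'b::ab_group_add \<Rightarrow> 'b) \<Rightarrow> nat \<Rightarrow> ((nat \<Rightarrow> nat) \<Rightarrow> 'b \<Rightarrow> 'b) \<Rightarrow> bool" where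
  "Sk_module scale k act \<longleftrightarrow>
     module scale \<and>
     act id = id \<and>
     (\<forall>\<sigma> \<tau>. \<sigma> permutes {1..k} \<longrightarrow> \<tau> permutes {1..k} \<longrightarrow> act (\<sigma> \<circ> \<tau>) = act \<sigma> \<circ> act \<tau>) \<and>
     (\<forall>\<sigma>. \<sigma> permutes {1..k} \<longrightarrow> module_hom scale scale (act \<sigma>))"

text \<open>Partitions are lists of parts (trailing zeros allowed). The chosen node (a,b) with a+b
  maximal: necessarily b = lambda_a, so we pick a row a (1-based, lambda_a > 0) maximising
  a + lambda_a; by the paper, the value does not depend on the choice.\<close>

definition Fnode :: "nat list \<Rightarrow> nat" where
  "Fnode xs = (ARG_MAX (\<lambda>i. i + xs ! (i - 1)) i. 1 \<le> i \<and> i \<le> length xs \<and> 0 < xs ! (i - 1))"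

lemma Fnode_props:
  assumes "\<not> (\<forall>x\<in>set xs. x = 0)"
  shows "1 \<le> Fnode xs \<and> Fnode xs \<le> length xs \<and> 0 < xs ! (Fnode xs - 1)"
proof -
  obtain j where j: "j < length xs" "xs ! j \<noteq> 0" using assms by (auto simp: in_set_conv_nth)
  have "1 \<le> Suc j \<and> Suc j \<le> length xs \<and> 0 < xs ! (Suc j - 1)" using j by auto
  moreover have "\<forall>y. (1 \<le> y \<and> y \<le> length xs \<and> 0 < xs ! (y - 1)) \<longrightarrow> y + xs ! (y - 1) < Suc (length xs + sum_list xs)"
  proof (intro allI impI)
    fix y assume y: "1 \<le> y \<and> y \<le> length xs \<and> 0 < xs ! (y - 1)"
    have "xs ! (y - 1) \<le> sum_list xs" by (rule elem_le_sum_list) (use y in linarith)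
    then show "y + xs ! (y - 1) < Suc (length xs + sum_list xs)" using y by simp
  qed
  ultimately show ?thesis unfolding Fnode_def
    by (rule arg_max_natI[where P="\<lambda>i. 1 \<le> i \<and> i \<le> length xs \<and> 0 < xs ! (i - 1)"])
qed

lemma sum_list_mono_minus: "sum_list (map (\<lambda>x. x - (b::nat)) ys) \<le> sum_list ys"
proof (induction ys)
  case Nil then show ?case by simp
next
  case (Cons y ys) then show ?case by simp
qed

lemma sum_list_minus_less:
  assumes "(b::nat) > 0" "a < length xs" "xs ! a \<ge> b"
  shows "sum_list (map (\<lambda>x. x - b) xs) < sum_list xs"
  using assms
proof (induction xs arbitrary: a)
  case Nil then show ?case by simp
next
  case (Cons y ys)
  have le: "sum_list (map (\<lambda>x. x - b) ys) \<le> sum_list ys"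
    using sum_list_mono_minus[of b ys] by simp
  show ?case
  proof (cases a)
    case 0 then show ?thesis using Cons.prems le by simp
  next
    case (Suc a') then show ?thesis using Cons.prems Cons.IH[of a'] by simp
  qed
qed

lemma sum_list_drop_less:
  fixes xs :: "nat list"
  assumes "0 < a" "a \<le> length xs" "0 < xs ! (a - 1)"
  shows "sum_list (drop a xs) < sum_list xs"
proof -
  have "sum_list xs = sum_list (take a xs) + sum_list (drop a xs)"
    by (metis append_take_drop_id sum_list_append)
  moreover have "xs ! (a - 1) \<le> sum_list (take a xs)"
  proof -
    have "take a xs ! (a - 1) = xs ! (a - 1)" using assms by simp
    moreover have "a - 1 < length (take a xs)" using assms by simp
    ultimately show ?thesis using elem_le_sum_list[of "a - 1" "take a xs"] by simp
  qed
  ultimately show ?thesis using assms by linarith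
qed

function Fpart :: "nat list \<Rightarrow> nat" where
  "Fpart xs = (if (\<forall>x\<in>set xs. x = 0) then 1 else
     (let a = Fnode xs; b = xs ! (a - 1) in
       ((a + b) choose a) * Fpart (drop a xs) * Fpart (map (\<lambda>x. x - b) xs)))"
  by auto
termination
proof (relation "measure sum_list")
  show "wf (measure sum_list)" by simp
next
  fix xs a b
  assume h: "\<not> (\<forall>x\<in>set xs. x = 0)" "a = Fnode xs" "b = xs ! (a - 1)"
  then show "(drop a xs, xs) \<in> measure sum_list"
    using Fnode_props[OF h(1)] sum_list_drop_less[of a xs] by simp
next
  fix xs a b
  assume h: "\<not> (\<forall>x\<in>set xs. x = 0)" "a = Fnode xs" "b = xs ! (a - 1)"
  then show "(map (\<lambda>x. x - b) xs, xs) \<in> measure sum_list"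
    using Fnode_props[OF h(1)] sum_list_minus_less[of b "a - 1" xs] by auto
qed

declare Fpart.simps[simp del]

end

theory Submission
  imports Defs Complex_Main
begin

text \<open>Encode a partition \<open>\<lambda>\<close> by the word that \<open>t\<^sub>\<lambda>\<close> makes out of \<open>A\<^sup>f B\<^sup>g\<close>, and match B with A
  like opening and closing brackets. In the permutation module on words, \<open>s\<^sub>\<lambda> m\<close> is the tensor
  product of antisymmetric tensors \<open>BA - AB\<close> over all matched pairs. Hence \<open>s\<^sub>i\<close> sends
  \<open>s\<^sub>\<lambda> m\<close> to \<open>-2 s\<^sub>\<lambda> m\<close>, to some \<open>s\<^sub>\<nu> m\<close> or to 0, as in the Temperley--Lieb algebra. Completing a
  word by letters B on the left and A on the right to a balanced word of length \<open>2 (f + g)\<close>,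
  \<open>F(\<lambda>)\<close> is \<open>(f + g)!\<close> divided by the product of the half-lengths of all chords. For these hook
  products a telescoping identity shows that \<open>\<Sum> F(\<lambda>) s\<^sub>\<lambda> m\<close> is annihilated by every
  \<open>s\<^sub>i\<close>, so it is a multiple of the sum of all words, and comparing the coefficients of
  \<open>B\<^sup>g A\<^sup>f\<close> shows that the multiple is 1.\<close>

section \<open>Balanced words and hook products\<close>

text \<open>The reciprocals of hook products have denominators that may vanish in the field. All
  summation therefore takes place over the rationals, on coefficients of words, and only the
  resulting identity between integers is carried to the module. The carrier is the map that sends a
  word to the image of \<open>m\<close> under any permutation producing that word; it is well
  defined because the Young subgroup of type (f, g) fixes \<open>m\<close>. The Temperley-Lieb
  behaviour rests on the letters spanning a plane: for an alternating form e on a plane, e(c,b) a -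
  e(c,a) b = e(a,b) c, which turns a difference of two tensors into a single one. The completion
  removes boundary cases. In a completed word the pair BA at the two positions of a generator always
  lies inside a further chord, and all words that the generator sends to a multiple of this one
  differ from it only within that chord. Everything outside is a common factor, so the vanishing
  reduces to a relation between two half-lengths.\<close>

datatype letter = A | B

inductive bal :: "letter list \<Rightarrow> bool" where
  bal_Nil: "bal []"
| bal_step: "bal v \<Longrightarrow> bal w \<Longrightarrow> bal (B # v @ A # w)"

lemma bal_append: "bal v \<Longrightarrow> bal w \<Longrightarrow> bal (v @ w)"
  by (induction rule: bal.induct) (auto dest: bal_step)

lemma bal_wrap: "bal v \<Longrightarrow> bal (B # v @ [A])"
  using bal_step[OF _ bal_Nil] by simp

fun ht :: "letter list \<Rightarrow> int" where
  "ht [] = 0"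
| "ht (B # w) = ht w + 1"
| "ht (A # w) = ht w - 1"

lemma ht_append [simp]: "ht (v @ w) = ht v + ht w"
  by (induction v rule: ht.induct) auto

lemma ht_replicate [simp]: "ht (replicate n A) = - int n" "ht (replicate n B) = int n"
  by (induction n) auto

lemma ht_count: "ht w = int (count_list w B) - int (count_list w A)"
  by (induction w rule: ht.induct) auto

lemma bal_ht: "bal v \<Longrightarrow> ht v = 0"
  by (induction rule: bal.induct) auto

lemma bal_prefix_ht:
  assumes "bal v" "v = p @ q"
  shows "ht p \<ge> 0"
  using assms
proof (induction arbitrary: p q rule: bal.induct)
  case bal_Nil
  then show ?case by simp
next
  case (bal_step v w)
  show ?case
  proof (cases p)
    case Nil
    then show ?thesis by simp
  next
    case (Cons c p')
    then have c: "c = B" and eq: "v @ A # w = p' @ q" using bal_step.prems by auto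
    from eq consider us where "v = p' @ us" | us where "p' = v @ us" "A # w = us @ q"
      unfolding append_eq_append_conv2 by blast
    then show ?thesis
    proof cases
      case 1
      then show ?thesis using bal_step.IH(1) Cons c by fastforce
    next
      case 2
      show ?thesis
      proof (cases us)
        case Nil
        then show ?thesis using 2 Cons c bal_ht[OF bal_step.hyps(1)] by simp
      next
        case (Cons d us')
        then have "d = A" "w = us' @ q" using 2 by auto
        then have "ht us' \<ge> 0" using bal_step.IH(2) by blast
        then show ?thesis
          using 2 Cons \<open>d = A\<close> c \<open>p = c # p'\<close> bal_ht[OF bal_step.hyps(1)] by simp
      qed
    qed
  qed
qed

lemma bal_suffix_ht: "bal (p @ q) \<Longrightarrow> ht q \<le> 0"
  using bal_prefix_ht[of "p @ q" p q] bal_ht[of "p @ q"] by simp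

section \<open>Words without an unmatched B, and the last unmatched letter\<close>

inductive closed_word :: "letter list \<Rightarrow> bool" where
  closed_Nil: "closed_word []"
| closed_A: "closed_word x \<Longrightarrow> closed_word (x @ [A])"
| closed_bal: "closed_word x \<Longrightarrow> bal v \<Longrightarrow> closed_word (x @ v)"

lemma closed_ht: "closed_word x \<Longrightarrow> ht x \<le> 0"
  by (induction rule: closed_word.induct) (auto simp: bal_ht)

text \<open>A final A either is unmatched or closes the last unmatched B of the rest. In the second
  case the search restarts to the left of that B, hence the induction on length.\<close>

lemma split_last_open:
  "closed_word x \<or> (\<exists>u v. x = u @ B # v \<and> bal v)"
proof (induction x rule: length_induct)
  case (1 x)
  show ?case
  proof (cases x rule: rev_cases)
    case Nil
    then show ?thesis by (simp add: closed_Nil)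
  next
    case (snoc x' c)
    show ?thesis
    proof (cases c)
      case B
      then show ?thesis using snoc bal_Nil by blast
    next
      case A
      consider "closed_word x'" | u v where "x' = u @ B # v" "bal v"
        using 1 snoc by auto
      then show ?thesis
      proof cases
        case 1
        then show ?thesis using closed_A snoc A by blast
      next
        case (2 u v)
        have bv: "bal (B # v @ [A])" using bal_wrap[OF 2(2)] .
        have x: "x = u @ (B # v @ [A])" using 2 snoc A by simp
        have "length u < length x" using x by simp
        then consider "closed_word u" | u' v' where "u = u' @ B # v'" "bal v'"
          using 1 by blast
        then show ?thesis
        proof cases
          case 1
          then show ?thesis using closed_bal[OF _ bv] x by blast
        next
          case (2 u' v')
          then have "x = u' @ B # (v' @ B # v @ [A])" using x by simp
          then show ?thesis using bal_append[OF 2(2) bv] by blast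
        qed
      qed
    qed
  qed
qed

lemma closed_cases:
  "closed_word x \<Longrightarrow> bal x \<or> (\<exists>x' v. x = x' @ A # v \<and> closed_word x' \<and> bal v)"
proof (induction rule: closed_word.induct)
  case closed_Nil
  then show ?case by (simp add: bal_Nil)
next
  case (closed_A x)
  then show ?case using bal_Nil by blast
next
  case (closed_bal x v)
  show ?case using closed_bal.IH
  proof
    assume "bal x" then show ?thesis using bal_append closed_bal.hyps(2) by blast
  next
    assume "\<exists>x' v. x = x' @ A # v \<and> closed_word x' \<and> bal v"
    then obtain x' w where "x = x' @ A # w" "closed_word x'" "bal w" by blast
    then have "x @ v = x' @ A # (w @ v)" "closed_word x'" "bal (w @ v)"
      using bal_append closed_bal.hyps(2) by auto
    then show ?thesis by blast
  qed
qed

text \<open>Converse of \<open>bal_prefix_ht\<close>. Look at the last unmatched letter: if it is a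
  B, the prefix before it has height -1; if it is an A, the prefix ending in it has negative
  height.\<close>

lemma bal_if_heights:
  assumes "ht w = 0" and nonneg: "\<And>p q. w = p @ q \<Longrightarrow> ht p \<ge> 0"
  shows "bal w"
proof -
  have "\<not> (\<exists>u v. w = u @ B # v \<and> bal v)"
  proof
    assume "\<exists>u v. w = u @ B # v \<and> bal v"
    then obtain u v where uv: "w = u @ B # v" "bal v" by blast
    then show False using nonneg[OF uv(1)] assms(1) bal_ht[OF uv(2)] by simp
  qed
  then have "closed_word w" using split_last_open by blast
  moreover have "\<not> (\<exists>x' v. w = x' @ A # v \<and> closed_word x' \<and> bal v)"
  proof
    assume "\<exists>x' v. w = x' @ A # v \<and> closed_word x' \<and> bal v"
    then obtain x' v where xv: "w = (x' @ [A]) @ v" "closed_word x'" by auto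
    then show False using nonneg[OF xv(1)] closed_ht[OF xv(2)] by simp
  qed
  ultimately show ?thesis using closed_cases by blast
qed

text \<open>If one of the two B lay in the balanced tail behind the other, that tail would have a
  suffix of height 1, but suffixes of balanced words have height at most 0.\<close>

lemma last_open_unique:
  assumes "u @ B # v = u' @ B # v'" "bal v" "bal v'"
  shows "u = u' \<and> v = v'"
proof -
  have aux: "us = []" if "B # v = us @ B # v'" "bal v" "bal v'" for us v v'
  proof (rule ccontr)
    assume "us \<noteq> []"
    then obtain us' where us: "us = B # us'" "v = us' @ B # v'"
      using \<open>B # v = us @ B # v'\<close> by (cases us) auto
    have "ht (B # v') \<le> 0" using bal_suffix_ht[of us' "B # v'"] that us by simp
    then show False using bal_ht[OF \<open>bal v'\<close>] by simp
  qed
  from assms(1) consider us where "u' = u @ us" "B # v = us @ B # v'"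
    | us where "u = u' @ us" "B # v' = us @ B # v"
    unfolding append_eq_append_conv2 by fastforce
  then show ?thesis
  proof cases
    case 1 then show ?thesis using aux[OF 1(2) assms(2,3)] by simp
  next
    case 2 then show ?thesis using aux[OF 2(2) assms(3,2)] by simp
  qed
qed

section \<open>Reflection of words and the first unmatched A\<close>

fun flip :: "letter \<Rightarrow> letter" where
  "flip A = B"
| "flip B = A"

lemma flip_flip [simp]: "flip (flip c) = c"
  by (cases c) auto

text \<open>Reading backwards with exchanged letters reflects the matching, so statements about the
  first unmatched A and about \<open>rsplits\<close> follow from those about the last unmatched B
  and \<open>lsplits\<close>.\<close>

definition mirror :: "letter list \<Rightarrow> letter list" where
  "mirror w = rev (map flip w)"

lemma mirror_simps [simp]:
  "mirror [] = []"
  "mirror (c # w) = mirror w @ [flip c]"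
  "mirror (v @ w) = mirror w @ mirror v"
  "mirror (mirror w) = w"
  "length (mirror w) = length w"
  by (auto simp: mirror_def rev_map comp_def)

lemma mirror_eq_iff: "mirror v = w \<longleftrightarrow> v = mirror w"
  by auto

lemma bal_mirror: "bal w \<Longrightarrow> bal (mirror w)"
proof (induction rule: bal.induct)
  case bal_Nil
  then show ?case by (simp add: bal.bal_Nil)
next
  case (bal_step v w)
  then show ?case using bal_append[OF bal_step.IH(2) bal_wrap[OF bal_step.IH(1)]] by simp
qed

lemma bal_mirror_iff [simp]: "bal (mirror w) = bal w"
  using bal_mirror[of w] bal_mirror[of "mirror w"] by auto

inductive open_word :: "letter list \<Rightarrow> bool" where
  open_Nil: "open_word []"
| open_B: "open_word y \<Longrightarrow> open_word (B # y)"
| open_bal: "bal v \<Longrightarrow> open_word y \<Longrightarrow> open_word (v @ y)"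

lemma closed_mirror: "closed_word x \<Longrightarrow> open_word (mirror x)"
  by (induction rule: closed_word.induct) (auto intro: open_word.intros)

lemma split_first_close:
  "open_word y \<or> (\<exists>v u. y = v @ A # u \<and> bal v)"
  using split_last_open[of "mirror y"]
proof
  assume "closed_word (mirror y)"
  then show ?thesis using closed_mirror[of "mirror y"] by simp
next
  assume "\<exists>u v. mirror y = u @ B # v \<and> bal v"
  then obtain u v where uv: "mirror y = u @ B # v" "bal v" by blast
  then have "y = mirror v @ A # mirror u" by (simp add: mirror_eq_iff)
  then show ?thesis using uv(2) bal_mirror by blast
qed

lemma first_close_unique:
  assumes "v @ A # u = v' @ A # u'" "bal v" "bal v'"
  shows "u = u' \<and> v = v'"
proof -
  have "mirror u @ B # mirror v = mirror u' @ B # mirror v'"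
    using arg_cong[OF assms(1), of mirror] by simp
  then have "mirror u = mirror u' \<and> mirror v = mirror v'"
    by (rule last_open_unique) (simp_all add: assms(2,3))
  then show ?thesis by (metis mirror_simps(4))
qed

lemma open_ht: "open_word x \<Longrightarrow> ht x \<ge> 0"
  by (induction rule: open_word.induct) (auto simp: bal_ht)

text \<open>The scan keeps the half-lengths of the words between consecutive unmatched letters B on
  a stack, so that every letter A contributes half the length of its chord.\<close>

fun hook_scan :: "nat list \<Rightarrow> letter list \<Rightarrow> nat" where
  "hook_scan st [] = 1"
| "hook_scan st (B # w) = hook_scan (0 # st) w"
| "hook_scan (c # d # st) (A # w) = Suc c * hook_scan (Suc (c + d) # st) w"
| "hook_scan [c] (A # w) = Suc c * hook_scan [Suc c] w"
| "hook_scan [] (A # w) = hook_scan [] w"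

abbreviation hook :: "letter list \<Rightarrow> nat" where
  "hook \<equiv> hook_scan [0]"

text \<open>This is half the length only for balanced words.\<close>

definition half :: "letter list \<Rightarrow> nat" where
  "half w = count_list w A"

lemma half_simps [simp]:
  "half [] = 0" "half (A # w) = Suc (half w)" "half (B # w) = half w"
  "half (v @ w) = half v + half w"
  by (auto simp: half_def)

lemma half_replicate [simp]: "half (replicate n A) = n" "half (replicate n B) = 0"
  by (induction n) auto

lemma hook_scan_bal_append:
  "bal v \<Longrightarrow> hook_scan (c # st) (v @ w) = hook v * hook_scan ((c + half v) # st) w"
proof (induction arbitrary: c st w rule: bal.induct)
  case bal_Nil
  then show ?case by simp
next
  case (bal_step v1 v2)
  have *: "hook_scan (c # st) (B # v1 @ A # v2 @ w)
    = hook v1 * (Suc (half v1) * (hook v2 * hook_scan ((Suc (half v1 + c) + half v2) # st) w))" for c st w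
    by (simp add: bal_step.IH)
  have **: "hook (B # v1 @ A # v2) = hook v1 * (Suc (half v1) * hook v2)"
    using *[of 0 "[]" "[]"] by simp
  show ?case unfolding append.simps append_assoc * ** by (simp add: algebra_simps)
qed

lemma hook_bal_append: "bal v \<Longrightarrow> bal w \<Longrightarrow> hook (v @ w) = hook v * hook w"
  using hook_scan_bal_append[of w "half v" "[]" "[]"] by (simp add: hook_scan_bal_append)

lemma hook_wrap: "bal v \<Longrightarrow> hook (B # v @ [A]) = Suc (half v) * hook v"
  by (simp add: hook_scan_bal_append)

lemma hook_step: "bal v \<Longrightarrow> bal w \<Longrightarrow> hook (B # v @ A # w) = Suc (half v) * hook v * hook w"
  using hook_bal_append[OF bal_wrap, of v w] hook_wrap[of v] by simp

lemma hook_pos: "hook_scan st w > 0"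
  by (induction st w rule: hook_scan.induct) auto

lemma half_mirror: "bal w \<Longrightarrow> half (mirror w) = half w"
  by (induction rule: bal.induct) auto

lemma hook_mirror: "bal w \<Longrightarrow> hook (mirror w) = hook w"
proof (induction rule: bal.induct)
  case bal_Nil
  then show ?case by simp
next
  case (bal_step v w)
  then show ?case
    using hook_bal_append[of "mirror w" "B # mirror v @ [A]"] bal_wrap[of "mirror v"]
    by (simp add: hook_step hook_wrap half_mirror del: hook_scan.simps)
qed

lemma hook_scan_prefix: "\<exists>K d st'. \<forall>w. hook_scan (c # st) (x @ w) = K * hook_scan (d # st') w"
proof (induction x arbitrary: c st)
  case Nil
  show ?case by (rule exI[of _ 1]) auto
next
  case (Cons l x)
  obtain K1 e1 st1 where 1: "\<forall>w. hook_scan (0 # c # st) (x @ w) = K1 * hook_scan (e1 # st1) w"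
    using Cons.IH by blast
  show ?case
  proof (cases l)
    case B then show ?thesis using 1 by auto
  next
    case A
    show ?thesis
    proof (cases st)
      case Nil
      obtain K e st1 where "\<forall>w. hook_scan [Suc c] (x @ w) = K * hook_scan (e # st1) w"
        using Cons.IH by blast
      then have "\<forall>w. hook_scan (c # st) ((l # x) @ w) = (Suc c * K) * hook_scan (e # st1) w"
        using A Nil by (simp add: algebra_simps)
      then show ?thesis by blast
    next
      case (Cons d st')
      obtain K e st1 where "\<forall>w. hook_scan (Suc (c + d) # st') (x @ w) = K * hook_scan (e # st1) w"
        using Cons.IH by blast
      then have "\<forall>w. hook_scan (c # st) ((l # x) @ w) = (Suc c * K) * hook_scan (e # st1) w"
        using A Cons by (simp add: algebra_simps)
      then show ?thesis by blast
    qed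
  qed
qed

text \<open>The chords outside \<open>v\<close> see \<open>v\<close> only through its half-length.
  This permits replacing one balanced factor by another of the same length.\<close>

lemma hook_context:
  "\<exists>K. \<forall>v. bal v \<and> half v = n \<longrightarrow> hook (x @ v @ y) = hook v * K"
proof -
  obtain K d st where "\<forall>w. hook (x @ w) = K * hook_scan (d # st) w" using hook_scan_prefix by blast
  then have "\<forall>v. bal v \<and> half v = n \<longrightarrow> hook (x @ v @ y) = hook v * (K * hook_scan ((d + n) # st) y)"
    by (auto simp: hook_scan_bal_append)
  then show ?thesis by blast
qed

declare hook_scan.simps(2-5) [simp del]

section \<open>Reciprocal hook products and their sums over splits\<close>

definition wt :: "letter list \<Rightarrow> rat" where
  "wt w = 1 / of_nat (hook w)"

text \<open>A split \<open>(u, v)\<close> of \<open>x\<close> stands for the word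
  \<open>u @ B # v @ A # A # y\<close>, which a generator acting on its displayed pair AA sends to
  \<open>x @ B # A # y\<close> (see \<open>s_op_AA\<close>). \<open>rsplits\<close> plays the same
  role for pairs BB.\<close>

definition lsplits :: "letter list \<Rightarrow> (letter list \<times> letter list) set" where
  "lsplits x = {(u, v). x = u @ A # v \<and> bal v}"

definition rsplits :: "letter list \<Rightarrow> (letter list \<times> letter list) set" where
  "rsplits y = {(v, u). y = v @ B # u \<and> bal v}"

lemma finite_splits: "finite (lsplits x)" "finite (rsplits x)"
proof -
  have *: "(u, v) \<in> (\<lambda>n. (take n x, drop (Suc n) x)) ` {..length x}" if "x = u @ c # v" for u v c
    using that by (intro image_eqI[of _ _ "length u"]) auto
  have "lsplits x \<subseteq> (\<lambda>n. (take n x, drop (Suc n) x)) ` {..length x}"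
    using * by (auto simp: lsplits_def)
  then show "finite (lsplits x)" by (rule finite_subset) simp
  have "rsplits x \<subseteq> (\<lambda>n. (take n x, drop (Suc n) x)) ` {..length x}"
    using * by (auto simp: rsplits_def)
  then show "finite (rsplits x)" by (rule finite_subset) simp
qed

lemma lsplits_step:
  assumes "bal v" "bal w"
  shows "lsplits (B # v @ A # w) =
    insert (B # v, w) ((\<lambda>(u, z). (B # v @ A # u, z)) ` lsplits w)" (is "?l = ?r")
proof
  show "?r \<subseteq> ?l" using assms by (auto simp: lsplits_def)
  show "?l \<subseteq> ?r"
  proof
    fix p assume "p \<in> ?l"
    then obtain u z where p: "p = (u, z)" "B # v @ A # w = u @ A # z" "bal z"
      by (auto simp: lsplits_def)
    from p(2) obtain u' where u: "u = B # u'" "v @ A # w = u' @ A # z"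
      by (cases u) auto
    from u(2) consider us where "u' = v @ us" "A # w = us @ A # z"
      | us where "v = u' @ us" "us @ A # w = A # z"
      unfolding append_eq_append_conv2 by fastforce
    then show "p \<in> ?r"
    proof cases
      case 1
      show ?thesis
      proof (cases us)
        case Nil then show ?thesis using 1 p u by simp
      next
        case (Cons c us')
        then show ?thesis using 1 p u by (auto simp: lsplits_def)
      qed
    next
      case 2
      show ?thesis
      proof (cases us)
        case Nil then show ?thesis using 2 p u by simp
      next
        case (Cons c us')
        then have c: "c = A" "z = (us' @ [A]) @ w" using 2 by auto
        have "v = (u' @ [A]) @ us'" using 2 Cons c by simp
        then have "ht (u' @ [A]) \<ge> 0" "ht v = 0"
          using bal_prefix_ht[OF assms(1)] bal_ht[OF assms(1)] by blast+
        moreover have "ht (us' @ [A]) \<ge> 0" using bal_prefix_ht[OF p(3) c(2)] .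
        moreover have "ht v = ht (u' @ [A]) + ht us'" using \<open>v = (u' @ [A]) @ us'\<close> by simp
        ultimately show ?thesis by simp
      qed
    qed
  qed
qed

lemma lsplits_Nil [simp]: "lsplits [] = {}"
  by (simp add: lsplits_def)

text \<open>The A at the split closes a top-level chord of \<open>w\<close>. Turning it into B
  leaves two open letters, which the appended AA closes.\<close>

lemma lsplits_bal:
  assumes "bal w" "(u, v) \<in> lsplits w"
  shows "bal (u @ B # v @ [A, A]) \<and> half (u @ B # v @ [A, A]) = Suc (half w)"
  using assms
proof (induction arbitrary: u v rule: bal.induct)
  case bal_Nil
  then show ?case by simp
next
  case (bal_step a b)
  then consider "u = B # a" "v = b" | u' where "u = B # a @ A # u'" "(u', v) \<in> lsplits b"
    by (auto simp: lsplits_step)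
  then show ?case
  proof cases
    case 1
    have "bal (B # (a @ B # b @ [A]) @ [A])"
      using bal_wrap[OF bal_append[OF bal_step.hyps(1) bal_wrap[OF bal_step.hyps(2)]]] .
    then show ?thesis using 1 by simp
  next
    case (2 u')
    then show ?thesis using bal.bal_step[OF bal_step.hyps(1)] bal_step.IH(2)[OF 2(2)] by simp
  qed
qed

text \<open>Write the word as a concatenation of chords. Letting the j-th chord swallow its successors
  multiplies the weight by a difference of two consecutive terms of a telescoping sum.\<close>

lemma lsplits_sum:
  assumes "bal w"
  shows "(\<Sum>(u, v)\<in>lsplits w. wt (u @ B # v @ [A, A])) = wt w * (1 - 1 / of_nat (Suc (half w)))"
  using assms
proof (induction rule: bal.induct)
  case bal_Nil
  then show ?case by simp
next
  case (bal_step a b)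
  have notin: "(B # a, b) \<notin> (\<lambda>(u, z). (B # a @ A # u, z)) ` lsplits b" by auto
  have inj: "inj_on (\<lambda>(u, z). (B # a @ A # u, z)) (lsplits b)" by (auto simp: inj_on_def)
  have first: "wt (B # a @ B # b @ [A, A])
      = 1 / (of_nat (half a + half b + 2) * of_nat (hook a) * of_nat (hook b) * of_nat (half b + 1))"
  proof -
    have "hook (B # (a @ B # b @ [A]) @ [A])
       = Suc (half a + half b + 1) * (hook a * (Suc (half b) * hook b))"
      using hook_wrap[OF bal_append[OF bal_step.hyps(1) bal_wrap[OF bal_step.hyps(2)]]]
        hook_bal_append[OF bal_step.hyps(1) bal_wrap[OF bal_step.hyps(2)]]
        hook_wrap[OF bal_step.hyps(2)] by simp
    then have "hook (B # a @ B # b @ [A, A])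
       = (half a + half b + 2) * hook a * hook b * (half b + 1)" by (simp add: algebra_simps)
    then show ?thesis unfolding wt_def of_nat_mult by (simp add: algebra_simps)
  qed
  have rest: "wt (B # a @ A # u @ B # v @ [A, A])
     = wt (u @ B # v @ [A, A]) / (of_nat (Suc (half a)) * of_nat (hook a))"
    if "(u, v) \<in> lsplits b" for u v
    unfolding wt_def using lsplits_bal[OF bal_step.hyps(2) that] bal_step.hyps(1)
    by (simp add: hook_step algebra_simps)
  have "(\<Sum>(u, v)\<in>lsplits (B # a @ A # b). wt (u @ B # v @ [A, A]))
     = wt (B # a @ B # b @ [A, A])
       + (\<Sum>(u, v)\<in>lsplits b. wt (B # a @ A # u @ B # v @ [A, A]))"
    unfolding lsplits_step[OF bal_step.hyps]
      sum.insert[OF finite_imageI[OF finite_splits(1)] notin] sum.reindex[OF inj]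
    by (simp add: case_prod_unfold comp_def)
  also have "(\<Sum>(u, v)\<in>lsplits b. wt (B # a @ A # u @ B # v @ [A, A]))
     = (\<Sum>(u, v)\<in>lsplits b. wt (u @ B # v @ [A, A]) / (of_nat (Suc (half a)) * of_nat (hook a)))"
    by (intro sum.cong refl) (auto simp: rest)
  also have "\<dots> = wt b * (1 - 1 / of_nat (Suc (half b))) / (of_nat (Suc (half a)) * of_nat (hook a))"
    using bal_step.IH(2) by (simp add: case_prod_unfold sum_divide_distrib[symmetric])
  also have "wt (B # a @ B # b @ [A, A]) + \<dots>
     = wt (B # a @ A # b) * (1 - 1 / of_nat (Suc (half (B # a @ A # b))))"
  proof -
    have p: "of_nat (hook a) \<noteq> (0::rat)" "of_nat (hook b) \<noteq> (0::rat)"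
      using hook_pos[of "[0]" a] hook_pos[of "[0]" b] by simp_all
    \<comment> \<open>X and Y are the half-lengths of chords around \<open>a\<close> and around
      \<open>b\<close>, and X + Y is that of the chord around \<open>a\<close> after it has
      swallowed the chord around \<open>b\<close>; P and Q are the hook products of \<open>a\<close>
      and \<open>b\<close>.\<close>
    have alg: "1 / ((X + Y) * P * Q * Y) + 1 / Q * (1 - 1 / Y) / (X * P)
      = 1 / (X * P * Q) * (1 - 1 / (X + Y))"
      if "X > 0" "Y > 0" "P \<noteq> 0" "Q \<noteq> 0" for X Y P Q :: rat
    proof -
      have "X \<noteq> 0" "Y \<noteq> 0" "X + Y \<noteq> 0" using that by auto
      then have "1 / ((X + Y) * Y) + (1 - 1 / Y) / X = (1 - 1 / (X + Y)) / X"
        by (simp add: divide_simps) (simp add: algebra_simps)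
      then have "(1 / ((X + Y) * Y) + (1 - 1 / Y) / X) * (1 / (P * Q))
        = (1 - 1 / (X + Y)) / X * (1 / (P * Q))" by simp
      then show ?thesis unfolding distrib_right times_divide_times_eq
        by (simp only: ac_simps mult_1 mult_1_right times_divide_eq_left times_divide_eq_right
            divide_divide_eq_left)
    qed
    have sum: "(of_nat (half a + half b + 2) :: rat)
        = of_nat (Suc (half a)) + of_nat (Suc (half b))"
      "(of_nat (Suc (half (B # a @ A # b))) :: rat)
        = of_nat (Suc (half a)) + of_nat (Suc (half b))" by simp_all
    show ?thesis
      unfolding first unfolding sum wt_def hook_step[OF bal_step.hyps] of_nat_mult
        Suc_eq_plus1[symmetric]
      by (rule alg) (use p in simp_all)
  qed
  finally show ?case .
qed

lemma rsplits_mirror: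
  "rsplits w = (\<lambda>(u, v). (mirror v, mirror u)) ` lsplits (mirror w)"
proof (intro set_eqI iffI)
  fix p assume "p \<in> rsplits w"
  then obtain v u where p: "p = (v, u)" "w = v @ B # u" "bal v" by (auto simp: rsplits_def)
  then have "(mirror u, mirror v) \<in> lsplits (mirror w)" by (simp add: lsplits_def)
  then show "p \<in> (\<lambda>(u, v). (mirror v, mirror u)) ` lsplits (mirror w)"
    using p by (intro image_eqI[of _ _ "(mirror u, mirror v)"]) auto
next
  fix p assume "p \<in> (\<lambda>(u, v). (mirror v, mirror u)) ` lsplits (mirror w)"
  then show "p \<in> rsplits w" by (auto simp: lsplits_def rsplits_def mirror_eq_iff)
qed

lemma rsplits_bal:
  assumes "bal w" "(v, u) \<in> rsplits w"
  shows "bal (B # B # v @ A # u) \<and> half (B # B # v @ A # u) = Suc (half w)"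
proof -
  have "(mirror u, mirror v) \<in> lsplits (mirror w)"
    using assms(2) by (auto simp: rsplits_def lsplits_def)
  then have *: "bal (mirror u @ B # mirror v @ [A, A])"
    and h: "half (mirror u @ B # mirror v @ [A, A]) = Suc (half (mirror w))"
    using lsplits_bal[of "mirror w"] assms(1) by auto
  have "mirror u @ B # mirror v @ [A, A] = mirror (B # B # v @ A # u)" by simp
  then show ?thesis
    using * h half_mirror[OF assms(1)] half_mirror[of "B # B # v @ A # u"]
    by (metis bal_mirror_iff)
qed

lemma rsplits_sum:
  assumes "bal w"
  shows "(\<Sum>(v, u)\<in>rsplits w. wt (B # B # v @ A # u)) = wt w * (1 - 1 / of_nat (Suc (half w)))"
proof -
  have inj: "inj_on (\<lambda>(u, v). (mirror v, mirror u)) (lsplits (mirror w))"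
    by (auto simp: inj_on_def mirror_eq_iff)
  have eq: "wt (B # B # mirror v @ A # mirror u) = wt (u @ B # v @ [A, A])"
    if "(u, v) \<in> lsplits (mirror w)" for u v
    using hook_mirror[of "u @ B # v @ [A, A]"] lsplits_bal[OF _ that] assms
    by (simp add: wt_def)
  have "(\<Sum>(v, u)\<in>rsplits w. wt (B # B # v @ A # u))
    = (\<Sum>(u, v)\<in>lsplits (mirror w). wt (u @ B # v @ [A, A]))"
    unfolding rsplits_mirror sum.reindex[OF inj]
    by (intro sum.cong) (auto simp: eq)
  then show ?thesis using lsplits_sum[of "mirror w"] assms
    by (simp add: wt_def hook_mirror half_mirror)
qed

lemma wt_append: "bal v \<Longrightarrow> bal w \<Longrightarrow> wt (v @ w) = wt v * wt w"
  by (simp add: wt_def hook_bal_append)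

lemma wt_wrap: "bal v \<Longrightarrow> wt (B # v @ [A]) = wt v / of_nat (Suc (half v))"
  by (simp add: wt_def hook_wrap algebra_simps)

lemma wt_BA: "wt [B, A] = 1"
  using hook_wrap[OF bal_Nil] by (simp add: wt_def)

lemma wt_context: "\<exists>K. \<forall>v. bal v \<and> half v = n \<longrightarrow> wt (x @ v @ y) = wt v * K"
proof -
  obtain K where K: "\<And>v. bal v \<Longrightarrow> half v = n \<Longrightarrow> hook (x @ v @ y) = hook v * K"
    using hook_context by blast
  have "wt (x @ v @ y) = wt v * (1 / of_nat K)" if "bal v" "half v = n" for v
    using K[OF that] by (simp add: wt_def)
  then show ?thesis by blast
qed

text \<open>Every term contains the factor \<open>wt L * wt R\<close>. With l and r the half-lengths
  of chords around \<open>L\<close> and \<open>R\<close>, the outer chord around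
  \<open>L @ B # A # R\<close> has half-length l + r, and what remains is 2/(l+r) = 1/(lr) +
  (1-1/l)/(l+r) + (1-1/r)/(l+r). It holds because 1/l + 1/r = (l+r)/(lr).\<close>

lemma wt_identity_bal:
  assumes "bal L" "bal R"
  shows "2 * wt (B # L @ B # A # R @ [A]) = wt (B # L @ A # B # R @ [A])
    + (\<Sum>(u, v)\<in>lsplits L. wt (B # u @ B # v @ A # A # R @ [A]))
    + (\<Sum>(v, u)\<in>rsplits R. wt (B # L @ B # B # v @ A # u @ [A]))"
proof -
  define l r where "l = (of_nat (Suc (half L)) :: rat)" and "r = (of_nat (Suc (half R)) :: rat)"
  have pos: "l > 0" "r > 0" by (simp_all add: l_def r_def del: of_nat_Suc)
  have lr: "of_nat (Suc (Suc (half L + half R))) = l + r" by (simp add: l_def r_def)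
  have BA: "bal [B, A]" using bal_wrap[OF bal_Nil] by simp
  have t0: "wt (B # L @ B # A # R @ [A]) = wt L * wt R / (l + r)"
    using wt_wrap[of "L @ [B, A] @ R"] wt_append[OF assms(1) bal_append[OF BA assms(2)]]
      wt_append[OF BA assms(2)] bal_append[OF assms(1) bal_append[OF BA assms(2)]]
    by (simp add: wt_BA lr del: of_nat_Suc)
  have t1: "wt (B # L @ A # B # R @ [A]) = wt L * wt R / (l * r)"
    using wt_append[OF bal_wrap[OF assms(1)] bal_wrap[OF assms(2)]] wt_wrap[OF assms(1)]
      wt_wrap[OF assms(2)] by (simp add: l_def r_def del: of_nat_Suc)
  have "wt (B # u @ B # v @ A # A # R @ [A]) = wt (u @ B # v @ [A, A]) * (wt R / (l + r))"
    if "(u, v) \<in> lsplits L" for u v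
  proof -
    note b = lsplits_bal[OF assms(1) that]
    have h: "Suc (half ((u @ B # v @ [A, A]) @ R)) = Suc (Suc (half L + half R))"
      using b by simp
    show ?thesis
      using wt_wrap[of "(u @ B # v @ [A, A]) @ R", unfolded h lr] b bal_append[OF conjunct1[OF b] assms(2)]
        wt_append[OF conjunct1[OF b] assms(2)] by (simp add: lr del: of_nat_Suc)
  qed
  then have "(\<Sum>(u, v)\<in>lsplits L. wt (B # u @ B # v @ A # A # R @ [A]))
     = (\<Sum>(u, v)\<in>lsplits L. wt (u @ B # v @ [A, A]) * (wt R / (l + r)))"
    by (intro sum.cong) auto
  also have "\<dots> = (\<Sum>(u, v)\<in>lsplits L. wt (u @ B # v @ [A, A])) * (wt R / (l + r))"
    by (simp only: sum_distrib_right case_prod_unfold)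
  also have "\<dots> = wt L * (1 - 1 / l) * (wt R / (l + r))"
    unfolding lsplits_sum[OF assms(1)] l_def ..
  finally have t2: "(\<Sum>(u, v)\<in>lsplits L. wt (B # u @ B # v @ A # A # R @ [A]))
     = wt L * (1 - 1 / l) * (wt R / (l + r))" .
  have "wt (B # L @ B # B # v @ A # u @ [A]) = wt (B # B # v @ A # u) * (wt L / (l + r))"
    if "(v, u) \<in> rsplits R" for u v
  proof -
    note b = rsplits_bal[OF assms(2) that]
    have h: "Suc (half (L @ (B # B # v @ A # u))) = Suc (Suc (half L + half R))"
      using b by simp
    show ?thesis
      using wt_wrap[of "L @ (B # B # v @ A # u)", unfolded h lr] b bal_append[OF assms(1) conjunct1[OF b]]
        wt_append[OF assms(1) conjunct1[OF b]] by (simp add: lr mult.commute del: of_nat_Suc)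
  qed
  then have "(\<Sum>(v, u)\<in>rsplits R. wt (B # L @ B # B # v @ A # u @ [A]))
     = (\<Sum>(v, u)\<in>rsplits R. wt (B # B # v @ A # u) * (wt L / (l + r)))"
    by (intro sum.cong) auto
  also have "\<dots> = (\<Sum>(v, u)\<in>rsplits R. wt (B # B # v @ A # u)) * (wt L / (l + r))"
    by (simp only: sum_distrib_right case_prod_unfold)
  also have "\<dots> = wt R * (1 - 1 / r) * (wt L / (l + r))"
    unfolding rsplits_sum[OF assms(2)] r_def ..
  finally have t3: "(\<Sum>(v, u)\<in>rsplits R. wt (B # L @ B # B # v @ A # u @ [A]))
     = wt R * (1 - 1 / r) * (wt L / (l + r))" .
  have "2 / (l + r) = 1 / (l * r) + (1 - 1 / l) / (l + r) + (1 - 1 / r) / (l + r)"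
  proof -
    have "l \<noteq> 0" "r \<noteq> 0" "l + r \<noteq> 0" using pos by auto
    then show ?thesis by (simp add: divide_simps) (simp add: algebra_simps)
  qed
  then have "wt L * wt R * (2 / (l + r))
    = wt L * wt R * (1 / (l * r) + (1 - 1 / l) / (l + r) + (1 - 1 / r) / (l + r))" by simp
  then show ?thesis unfolding t0 t1 t2 t3 distrib_left
    by (simp only: ac_simps mult_1 mult_1_right times_divide_eq_left times_divide_eq_right)
qed

section \<open>Localisation of the identity to one chord\<close>

lemma lsplits_open:
  assumes "bal L"
  shows "lsplits (Z @ B # L) = (\<lambda>(u, v). (Z @ B # u, v)) ` lsplits L" (is "?l = ?r")
proof
  show "?r \<subseteq> ?l" by (auto simp: lsplits_def)
  show "?l \<subseteq> ?r"
  proof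
    fix p assume "p \<in> ?l"
    then obtain u v where p: "p = (u, v)" "(Z @ [B]) @ L = u @ (A # v)" "bal v"
      by (auto simp: lsplits_def)
    from p(2) consider us where "Z @ [B] = u @ us" "us @ L = A # v"
      | us where "(Z @ [B]) @ us = u" "L = us @ A # v"
      unfolding append_eq_append_conv2 by blast
    then show "p \<in> ?r"
    proof cases
      case 1
      show ?thesis
      proof (cases us rule: rev_cases)
        case Nil then show ?thesis using 1 p by (auto simp: lsplits_def)
      next
        case (snoc us' c)
        then have c: "c = B" using 1 by simp
        then obtain us'' where "v = us'' @ B # L" using 1 snoc by (cases us') auto
        then have "ht (B # L) \<le> 0" using bal_suffix_ht p(3) by blast
        then show ?thesis using bal_ht[OF assms] by simp
      qed
    next
      case 2
      then show ?thesis using p by (auto simp: lsplits_def)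
    qed
  qed
qed

lemma rsplits_closed:
  assumes "bal R"
  shows "rsplits (R @ A # Z) = (\<lambda>(v, u). (v, u @ A # Z)) ` rsplits R"
proof -
  have "rsplits (R @ A # Z)
    = (\<lambda>(u, v). (mirror v, mirror u)) ` lsplits (mirror Z @ B # mirror R)"
    by (simp add: rsplits_mirror)
  also have "\<dots> = (\<lambda>(v, u). (v, u @ A # Z)) ` rsplits R"
    using assms by (simp add: rsplits_mirror[of R] lsplits_open image_image case_prod_unfold)
  finally show ?thesis .
qed

text \<open>The last unmatched B of \<open>X\<close> and the first unmatched A of \<open>Y\<close>
  form a chord around the pair BA. The other words rearrange only the letters from this B to this A,
  into balanced words of the same length, so \<open>wt_context\<close> gives all terms one common
  factor \<open>K\<close>.\<close>

lemma wt_identity: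
  assumes "ht X > 0" "ht Y < 0"
  shows "2 * wt (X @ B # A # Y) = wt (X @ A # B # Y)
    + (\<Sum>(u, v)\<in>lsplits X. wt (u @ B # v @ A # A # Y))
    + (\<Sum>(v, u)\<in>rsplits Y. wt (X @ B # B # v @ A # u))"
proof -
  obtain Z L where X: "X = Z @ B # L" "bal L"
    using split_last_open[of X] closed_ht[of X] assms(1) by auto
  obtain R Z' where Y: "Y = R @ A # Z'" "bal R"
    using split_first_close[of Y] open_ht[of Y] assms(2) by auto
  define n where "n = half L + half R + 2"
  obtain K where K: "\<And>v. bal v \<Longrightarrow> half v = n \<Longrightarrow> wt (Z @ v @ Z') = wt v * K"
    using wt_context[of n Z Z'] by blast
  have BA: "bal [B, A]" using bal_wrap[OF bal_Nil] by simp
  have t0: "wt (X @ B # A # Y) = wt (B # L @ B # A # R @ [A]) * K"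
    using K[of "B # (L @ [B, A] @ R) @ [A]"]
      bal_wrap[OF bal_append[OF X(2) bal_append[OF BA Y(2)]]] X Y by (simp add: n_def)
  have t1: "wt (X @ A # B # Y) = wt (B # L @ A # B # R @ [A]) * K"
    using K[of "(B # L @ [A]) @ (B # R @ [A])"]
      bal_append[OF bal_wrap[OF X(2)] bal_wrap[OF Y(2)]] X Y by (simp add: n_def)
  have 2: "wt (Z @ B # u @ B # v @ A # A # Y) = wt (B # u @ B # v @ A # A # R @ [A]) * K"
    if "(u, v) \<in> lsplits L" for u v
    using K[of "B # ((u @ B # v @ [A, A]) @ R) @ [A]"] lsplits_bal[OF X(2) that]
      bal_wrap[OF bal_append[of "u @ B # v @ [A, A]", OF _ Y(2)]] Y by (simp add: n_def)
  have "(\<Sum>(u, v)\<in>lsplits X. wt (u @ B # v @ A # A # Y))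
     = (\<Sum>(u, v)\<in>lsplits L. wt (Z @ B # u @ B # v @ A # A # Y))"
    unfolding X(1) lsplits_open[OF X(2)]
    by (subst sum.reindex) (auto simp: inj_on_def case_prod_unfold)
  also have "\<dots> = (\<Sum>(u, v)\<in>lsplits L. wt (B # u @ B # v @ A # A # R @ [A]) * K)"
    using 2 by (intro sum.cong) auto
  also have "\<dots> = (\<Sum>(u, v)\<in>lsplits L. wt (B # u @ B # v @ A # A # R @ [A])) * K"
    by (simp only: sum_distrib_right case_prod_unfold)
  finally have t2: "(\<Sum>(u, v)\<in>lsplits X. wt (u @ B # v @ A # A # Y))
    = (\<Sum>(u, v)\<in>lsplits L. wt (B # u @ B # v @ A # A # R @ [A])) * K" .
  have 3: "wt (X @ B # B # v @ A # u @ A # Z') = wt (B # L @ B # B # v @ A # u @ [A]) * K"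
    if "(v, u) \<in> rsplits R" for u v
    using K[of "B # (L @ (B # B # v @ A # u)) @ [A]"] rsplits_bal[OF Y(2) that]
      bal_wrap[OF bal_append[of L "B # B # v @ A # u", OF X(2)]] X by (simp add: n_def)
  have "(\<Sum>(v, u)\<in>rsplits Y. wt (X @ B # B # v @ A # u))
     = (\<Sum>(v, u)\<in>rsplits R. wt (X @ B # B # v @ A # u @ A # Z'))"
    unfolding Y(1) rsplits_closed[OF Y(2)]
    by (subst sum.reindex) (auto simp: inj_on_def case_prod_unfold)
  also have "\<dots> = (\<Sum>(v, u)\<in>rsplits R. wt (B # L @ B # B # v @ A # u @ [A]) * K)"
    using 3 by (intro sum.cong) auto
  also have "\<dots> = (\<Sum>(v, u)\<in>rsplits R. wt (B # L @ B # B # v @ A # u @ [A])) * K"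
    by (simp only: sum_distrib_right case_prod_unfold)
  finally have t3: "(\<Sum>(v, u)\<in>rsplits Y. wt (X @ B # B # v @ A # u))
    = (\<Sum>(v, u)\<in>rsplits R. wt (B # L @ B # B # v @ A # u @ [A])) * K" .
  show ?thesis using arg_cong[OF wt_identity_bal[OF X(2) Y(2)], of "\<lambda>z. z * K"]
    unfolding t0 t1 t2 t3 by (simp add: algebra_simps)
qed

section \<open>Completed words and their weights\<close>

lemma lsplits_replicate_B:
  "lsplits (replicate n B @ x) = (\<lambda>(u, v). (replicate n B @ u, v)) ` lsplits x"
proof (induction n)
  case 0
  then show ?case by simp
next
  case (Suc n)
  have "lsplits (B # w) = (\<lambda>(u, v). (B # u, v)) ` lsplits w" for w
    by (auto simp: lsplits_def Cons_eq_append_conv image_iff)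
  then show ?case using Suc by (simp add: image_image case_prod_unfold)
qed

lemma mirror_replicate [simp]: "mirror (replicate n c) = replicate n (flip c)"
  by (simp add: mirror_def)

lemma rsplits_replicate_A:
  "rsplits (y @ replicate n A) = (\<lambda>(v, u). (v, u @ replicate n A)) ` rsplits y"
  by (simp add: rsplits_mirror lsplits_replicate_B image_image case_prod_unfold)

lemma count_list_replicate [simp]: "count_list (replicate n a) b = (if a = b then n else 0)"
  by (induction n) auto

definition words :: "nat \<Rightarrow> nat \<Rightarrow> letter list set" where
  "words f g = {w. count_list w A = f \<and> count_list w B = g}"

definition weight :: "nat \<Rightarrow> nat \<Rightarrow> letter list \<Rightarrow> rat" where
  "weight f g w = wt (replicate f B @ w @ replicate g A)"

text \<open>Besides the displayed pair, \<open>x\<close> has fewer than f letters A and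
  \<open>y\<close> fewer than g letters B. The padding therefore forces an unmatched B on the left
  and an unmatched A on the right, as \<open>wt_identity\<close> requires. It creates no new splits,
  since a left split happens at an A and a right split at a B.\<close>

lemma weight_identity:
  assumes "x @ B # A # y \<in> words f g"
  shows "2 * weight f g (x @ B # A # y) = weight f g (x @ A # B # y)
    + (\<Sum>(u, v)\<in>lsplits x. weight f g (u @ B # v @ A # A # y))
    + (\<Sum>(v, u)\<in>rsplits y. weight f g (x @ B # B # v @ A # u))"
proof -
  let ?X = "replicate f B @ x" and ?Y = "y @ replicate g A"
  have "ht ?X > 0" "ht ?Y < 0" using assms by (auto simp: words_def ht_count)
  note id = wt_identity[OF this]
  have l: "(\<Sum>(u, v)\<in>lsplits ?X. wt (u @ B # v @ A # A # ?Y))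
    = (\<Sum>(u, v)\<in>lsplits x. weight f g (u @ B # v @ A # A # y))"
    unfolding lsplits_replicate_B
    by (subst sum.reindex) (auto simp: inj_on_def case_prod_unfold weight_def)
  have r: "(\<Sum>(v, u)\<in>rsplits ?Y. wt (?X @ B # B # v @ A # u))
    = (\<Sum>(v, u)\<in>rsplits y. weight f g (x @ B # B # v @ A # u))"
    unfolding rsplits_replicate_A
    by (subst sum.reindex) (auto simp: inj_on_def case_prod_unfold weight_def)
  show ?thesis using id unfolding l r by (simp add: weight_def)
qed

section \<open>The action of the Coxeter generators on words\<close>

text \<open>The alternating form on the plane spanned by the two letters, with values the
  coefficients of BA - AB.\<close>

fun eps :: "letter \<Rightarrow> letter \<Rightarrow> int" where
  "eps B A = 1"
| "eps A B = -1"
| "eps _ _ = 0"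

text \<open>The coefficient of the word \<open>u\<close> in the tensor product over all matched pairs
  of letters of \<open>w\<close> of the antisymmetric tensors \<open>B \<otimes> A - A \<otimes> B\<close>, where
  unmatched letters are left alone. The stack holds the letters of \<open>u\<close> at the positions where
  \<open>w\<close> has a letter B that is still unmatched; below it are infinitely many invisible B's.\<close>

fun coeff :: "letter list \<Rightarrow> letter list \<Rightarrow> letter list \<Rightarrow> int" where
  "coeff st [] [] = (if set st \<subseteq> {B} then 1 else 0)"
| "coeff st (B # w) (a # u) = coeff (a # st) w u"
| "coeff (b # st) (A # w) (a # u) = eps b a * coeff st w u"
| "coeff [] (A # w) (a # u) = eps B a * coeff [] w u"
| "coeff _ _ _ = 0"

lemma coeff_bottom: "coeff (st @ [B]) w u = coeff st w u"
proof (induction st w u rule: coeff.induct)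
  case (2 st w a u)
  then show ?case by (simp flip: append_Cons)
qed auto

lemma coeff_bal_append:
  "bal v \<Longrightarrow> length p = length v \<Longrightarrow> coeff st (v @ w) (p @ u) = coeff [] v p * coeff st w u"
proof (induction arbitrary: p st w u rule: bal.induct)
  case bal_Nil
  then show ?case by simp
next
  case (bal_step v1 v2)
  obtain a p1 b p2 where p: "p = a # p1 @ b # p2" "length p1 = length v1" "length p2 = length v2"
  proof -
    obtain a q where q: "p = a # q" "length q = length v1 + Suc (length v2)"
      using bal_step.prems by (cases p) auto
    obtain b p2 where b: "drop (length v1) q = b # p2" "length p2 = length v2"
      using q(2) by (cases "drop (length v1) q") (auto dest: arg_cong[of _ _ length])
    have "q = take (length v1) q @ b # p2" using b(1) by (metis append_take_drop_id)
    then show thesis using that[of a "take (length v1) q" b p2] q b by simp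
  qed
  have *: "coeff st (B # v1 @ A # v2 @ w) (a # p1 @ b # p2 @ u)
     = coeff [] v1 p1 * eps a b * coeff [] v2 p2 * coeff st w u" for st w u
    using bal_step.IH(1)[OF p(2), of "a # st" "A # v2 @ w" "b # p2 @ u"]
      bal_step.IH(2)[OF p(3), of st w u] by simp
  show ?case using *[of st w u] *[of "[]" "[]" "[]"] p by simp
qed

lemma coeff_prefix:
  "length p = length x \<Longrightarrow> \<exists>K st'. \<forall>w u. coeff st (x @ w) (p @ u) = K * coeff st' w u"
proof (induction x arbitrary: p st)
  case Nil
  show ?case by (rule exI[of _ 1]) (use Nil in auto)
next
  case (Cons c x)
  obtain a q where p: "p = a # q" "length q = length x" using Cons.prems by (cases p) auto
  obtain st1 k where 1: "\<And>w u. coeff st ((c # x) @ w) (p @ u) = k * coeff st1 (x @ w) (q @ u)"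
  proof (cases c)
    case A
    show ?thesis
    proof (cases st)
      case Nil then show ?thesis using that[of "eps B a" "[]"] A p by simp
    next
      case (Cons b st') then show ?thesis using that[of "eps b a" st'] A p by simp
    qed
  next
    case B
    then show ?thesis using that[of 1 "a # st"] p by simp
  qed
  obtain K st' where "\<forall>w u. coeff st1 (x @ w) (q @ u) = K * coeff st' w u"
    using Cons.IH[OF p(2)] by blast
  then have "\<forall>w u. coeff st ((c # x) @ w) (p @ u) = (k * K) * coeff st' w u" using 1 by simp
  then show ?case by blast
qed

text \<open>Revealing one of the invisible letters B makes the stack nonempty, so that a matched and
  an unmatched A are treated alike from here on.\<close>

lemma coeff_prefix_Cons:
  assumes "length p = length x"
  shows "\<exists>K c st'. \<forall>w u. coeff st (x @ w) (p @ u) = K * coeff (c # st') w u"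
proof -
  obtain K st' where K: "\<forall>w u. coeff st (x @ w) (p @ u) = K * coeff (st' @ [B]) w u"
    using coeff_prefix[OF assms] unfolding coeff_bottom by blast
  obtain c st'' where "st' @ [B] = c # st''" by (cases st') auto
  then show ?thesis using K by metis
qed

lemma coeff_closed:
  "closed_word x \<Longrightarrow> length p = length x \<Longrightarrow> \<exists>K. \<forall>w u. coeff [] (x @ w) (p @ u) = K * coeff [] w u"
proof (induction arbitrary: p rule: closed_word.induct)
  case closed_Nil
  show ?case by (rule exI[of _ 1]) (use closed_Nil in auto)
next
  case (closed_A x)
  then obtain q a where p: "p = q @ [a]" "length q = length x" by (cases p rule: rev_cases) auto
  obtain K where "\<forall>w u. coeff [] (x @ w) (q @ u) = K * coeff [] w u" using closed_A.IH p(2) by blast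
  then have "\<forall>w u. coeff [] ((x @ [A]) @ w) (p @ u) = (K * eps B a) * coeff [] w u" using p by simp
  then show ?case by blast
next
  case (closed_bal x v)
  define q r where "q = take (length x) p" and "r = drop (length x) p"
  have p: "p = q @ r" "length q = length x" "length r = length v"
    using closed_bal.prems by (auto simp: q_def r_def)
  obtain K where "\<forall>w u. coeff [] (x @ w) (q @ u) = K * coeff [] w u"
    using closed_bal.IH p(2) by blast
  then have "\<forall>w u. coeff [] ((x @ v) @ w) (p @ u) = (K * coeff [] v r) * coeff [] w u"
    using p coeff_bal_append[OF closed_bal.hyps(2) p(3)] by simp
  then show ?case by blast
qed

text \<open>An open word never pops below the initial level of the stack, so the letters stored
  there are only tested at the end, where each must be B.\<close>

lemma coeff_open:
  "open_word y \<Longrightarrow> length u = length y \<Longrightarrow> coeff st y u = (if set st \<subseteq> {B} then coeff [] y u else 0)"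
proof (induction arbitrary: u st rule: open_word.induct)
  case open_Nil
  then show ?case by simp
next
  case (open_B y)
  then obtain a q where "u = a # q" "length q = length y" by (cases u) auto
  then show ?case using open_B.IH[of q "a # st"] open_B.IH[of q "[a]"] by simp
next
  case (open_bal v y)
  define q r where "q = take (length v) u" and "r = drop (length v) u"
  have u: "u = q @ r" "length q = length v" "length r = length y"
    using open_bal.prems by (auto simp: q_def r_def)
  show ?case using open_bal.IH[OF u(3), of st] open_bal.IH[OF u(3), of "[]"] u
      coeff_bal_append[OF open_bal.hyps(1) u(2), of st y r]
      coeff_bal_append[OF open_bal.hyps(1) u(2), of "[]" y r] by simp
qed

section \<open>The Coxeter generators on coefficient functions\<close>

definition swap :: "nat \<Rightarrow> letter list \<Rightarrow> letter list" where
  "swap i w = w[i - 1 := w ! i, i := w ! (i - 1)]"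

definition s_op :: "nat \<Rightarrow> (letter list \<Rightarrow> int) \<Rightarrow> letter list \<Rightarrow> int" where
  "s_op i \<phi> w = \<phi> (swap i w) - \<phi> w"

lemma length_swap [simp]: "length (swap i w) = length w"
  by (simp add: swap_def)

lemma swap_append: "swap (Suc (length x)) (x @ a # b # y) = x @ b # a # y"
  by (simp add: swap_def list_update_append nth_append)

lemma word_split2:
  assumes "length w = n + 2 + k"
  shows "\<exists>p a b q. w = p @ a # b # q \<and> length p = n \<and> length q = k"
proof -
  obtain a r where a: "drop n w = a # r" "length r = Suc k"
    using assms by (cases "drop n w") (auto dest: arg_cong[of _ _ length])
  obtain b q where b: "r = b # q" "length q = k" using a(2) by (cases r) auto
  have "w = take n w @ a # b # q" using a(1) b(1) by (metis append_take_drop_id)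
  moreover have "length (take n w) = n" using assms by simp
  ultimately show ?thesis using b(2) by blast
qed

text \<open>The two positions are the ends of one chord, whose tensor BA - AB changes sign under the
  exchange.\<close>

lemma s_op_BA:
  assumes "length w = length (x @ B # A # y)"
  shows "s_op (Suc (length x)) (coeff [] (x @ B # A # y)) w = - 2 * coeff [] (x @ B # A # y) w"
proof -
  obtain p a b q where w: "w = p @ a # b # q" "length p = length x" "length q = length y"
    using word_split2[of w "length x" "length y"] assms by auto
  obtain K st where K: "\<And>w u. coeff [] (x @ w) (p @ u) = K * coeff st w u"
    using coeff_prefix[OF w(2)] by blast
  have "swap (Suc (length x)) w = p @ b # a # q" using swap_append[of p] w by simp
  then show ?thesis unfolding s_op_def w(1) by (cases a; cases b) (simp_all add: K w(1))
qed

text \<open>With \<open>c\<close> the letter at the partner of the A, this is the three-term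
  relation e(c,b) a - e(c,a) b = e(a,b) c for the letter left on the stack. The cases over
  \<open>a\<close>, \<open>b\<close>, \<open>c\<close> verify it.\<close>

lemma s_op_AB:
  assumes "length w = length (x @ A # B # y)"
  shows "s_op (Suc (length x)) (coeff [] (x @ A # B # y)) w = coeff [] (x @ B # A # y) w"
proof -
  obtain p a b q where w: "w = p @ a # b # q" "length p = length x" "length q = length y"
    using word_split2[of w "length x" "length y"] assms by auto
  obtain K c st where K: "\<And>w u. coeff [] (x @ w) (p @ u) = K * coeff (c # st) w u"
    using coeff_prefix_Cons[OF w(2)] by blast
  have "swap (Suc (length x)) w = p @ b # a # q" using swap_append[of p] w by simp
  then show ?thesis unfolding s_op_def w(1) by (cases a; cases b; cases c) (simp_all add: K w(1))
qed

text \<open>The relation e(d,b) e(c,a) - e(d,a) e(c,b) = e(c,d) e(a,b): the partners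
  \<open>d\<close> and \<open>c\<close> of the two letters A become matched with each other, and so
  do the two positions of the generator.\<close>

lemma s_op_AA:
  assumes "bal v" "length w = length (u @ B # v @ A # A # y)"
  shows "s_op (Suc (length (u @ B # v))) (coeff [] (u @ B # v @ A # A # y)) w
    = coeff [] (u @ A # v @ B # A # y) w"
proof -
  obtain p' a b q where w: "w = p' @ a # b # q" "length p' = length (u @ B # v)" "length q = length y"
    using word_split2[of w "length (u @ B # v)" "length y"] assms by auto
  obtain d r where d: "drop (length u) p' = d # r" "length r = length v"
    using w(2) by (cases "drop (length u) p'") (auto dest: arg_cong[of _ _ length])
  define p where "p = take (length u) p'"
  have p': "p' = p @ d # r" "length p = length u"
    using d(1) w(2) by (auto simp: p_def) (metis append_take_drop_id)
  obtain K c st where K: "\<And>w z. coeff [] (u @ w) (p @ z) = K * coeff (c # st) w z"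
    using coeff_prefix_Cons[OF p'(2)] by blast
  have w': "w = p @ d # r @ a # b # q" using w p' by simp
  have sw: "swap (Suc (length (u @ B # v))) w = p @ d # r @ b # a # q"
    using swap_append[of p' a b q] w p' by simp
  show ?thesis unfolding s_op_def sw unfolding w'
    by (cases a; cases b; cases c; cases d) (simp_all add: K coeff_bal_append[OF assms(1) d(2)])
qed

text \<open>Both letters A are unmatched, so the coefficient is symmetric in the two
  positions.\<close>

lemma s_op_AA_closed:
  assumes "closed_word x" "length w = length (x @ A # A # y)"
  shows "s_op (Suc (length x)) (coeff [] (x @ A # A # y)) w = 0"
proof -
  obtain p a b q where w: "w = p @ a # b # q" "length p = length x" "length q = length y"
    using word_split2[of w "length x" "length y"] assms by auto
  obtain K where K: "\<And>w u. coeff [] (x @ w) (p @ u) = K * coeff [] w u"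
    using coeff_closed[OF assms(1) w(2)] by blast
  have "swap (Suc (length x)) w = p @ b # a # q" using swap_append[of p] w by simp
  then show ?thesis unfolding s_op_def w(1) by (simp add: K)
qed

text \<open>Again the three-term relation, now as e(a,d) b - e(b,d) a = e(a,b) d, where
  \<open>d\<close> is the letter at the partner of the second B.\<close>

lemma s_op_BB:
  assumes "bal v" "length w = length (x @ B # B # v @ A # u)"
  shows "s_op (Suc (length x)) (coeff [] (x @ B # B # v @ A # u)) w
    = coeff [] (x @ B # A # v @ B # u) w"
proof -
  obtain p a b q' where w: "w = p @ a # b # q'" "length p = length x"
      "length q' = length (v @ A # u)"
    using word_split2[of w "length x" "length (v @ A # u)"] assms by auto
  obtain d q where d: "drop (length v) q' = d # q"
    using w(3) by (cases "drop (length v) q'") (auto dest: arg_cong[of _ _ length])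
  define r where "r = take (length v) q'"
  have q': "q' = r @ d # q" "length r = length v"
    using d(1) w(3) by (auto simp: r_def) (metis append_take_drop_id)
  obtain K st where K: "\<And>w z. coeff [] (x @ w) (p @ z) = K * coeff st w z"
    using coeff_prefix[OF w(2)] by blast
  have sw: "swap (Suc (length x)) w = p @ b # a # r @ d # q" using swap_append[of p] w q' by simp
  have w': "w = p @ a # b # r @ d # q" using w q' by simp
  show ?thesis unfolding s_op_def sw unfolding w'
    by (cases a; cases b; cases d) (simp_all add: K coeff_bal_append[OF assms(1) q'(2)])
qed

lemma s_op_BB_open:
  assumes "open_word y" "length w = length (x @ B # B # y)"
  shows "s_op (Suc (length x)) (coeff [] (x @ B # B # y)) w = 0"
proof -
  obtain p a b q where w: "w = p @ a # b # q" "length p = length x" "length q = length y"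
    using word_split2[of w "length x" "length y"] assms by auto
  obtain K st where K: "\<And>w u. coeff [] (x @ w) (p @ u) = K * coeff st w u"
    using coeff_prefix[OF w(2)] by blast
  have "swap (Suc (length x)) w = p @ b # a # q" using swap_append[of p] w by simp
  then show ?thesis unfolding s_op_def w(1)
    using coeff_open[OF assms(1) w(3), of "a # b # st"] coeff_open[OF assms(1) w(3), of "b # a # st"]
    by (simp add: K)
qed

section \<open>Sums over all words, grouped by the letters at two adjacent positions\<close>

lemma finite_words: "finite (words f g)"
proof -
  have len: "length w = count_list w A + count_list w B" for w
    by (induction w rule: ht.induct) auto
  have "(UNIV :: letter set) = {A, B}" using letter.exhaust by auto
  then have "finite (UNIV :: letter set)" by (metis finite.emptyI finite_insert)
  then have "finite {w :: letter list. set w \<subseteq> UNIV \<and> length w = f + g}"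
    by (rule finite_lists_length_eq)
  moreover have "words f g \<subseteq> {w. set w \<subseteq> UNIV \<and> length w = f + g}"
    by (auto simp: words_def len)
  ultimately show ?thesis by (rule finite_subset[rotated])
qed

lemma length_words: "w \<in> words f g \<Longrightarrow> length w = f + g"
  unfolding words_def by (induction w arbitrary: f g rule: ht.induct) auto

definition cuts :: "nat \<Rightarrow> nat \<Rightarrow> nat \<Rightarrow> letter \<Rightarrow> letter \<Rightarrow> (letter list \<times> letter list) set" where
  "cuts f g n a b = {(x, y). length x = n \<and> x @ a # b # y \<in> words f g}"

lemma finite_cuts: "finite (cuts f g n a b)"
proof -
  have "inj_on (\<lambda>(x, y). x @ a # b # y) (cuts f g n a b)"
    by (auto simp: inj_on_def cuts_def)
  moreover have "(\<lambda>(x, y). x @ a # b # y) ` cuts f g n a b \<subseteq> words f g"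
    by (auto simp: cuts_def)
  ultimately show ?thesis using finite_words finite_subset finite_imageD by metis
qed

lemma sum_words_cuts:
  fixes G :: "letter list \<Rightarrow> rat"
  assumes "n + 2 \<le> f + g"
  shows "(\<Sum>w\<in>words f g. G w) = (\<Sum>(x, y)\<in>cuts f g n A A. G (x @ A # A # y))
    + (\<Sum>(x, y)\<in>cuts f g n A B. G (x @ A # B # y)) + (\<Sum>(x, y)\<in>cuts f g n B A. G (x @ B # A # y))
    + (\<Sum>(x, y)\<in>cuts f g n B B. G (x @ B # B # y))"
proof -
  let ?U = "{(A, A), (A, B), (B, A), (B, B)}"
  let ?S = "Sigma ?U (\<lambda>(a, b). cuts f g n a b)"
  let ?h = "\<lambda>((a, b), (x, y)). x @ a # b # y"
  have "inj_on ?h ?S" by (auto simp: inj_on_def cuts_def)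
  moreover have "?h ` ?S = words f g"
  proof
    show "?h ` ?S \<subseteq> words f g" by (auto simp: cuts_def)
    show "words f g \<subseteq> ?h ` ?S"
    proof
      fix w assume w: "w \<in> words f g"
      then have "length w = n + 2 + (f + g - n - 2)" using length_words assms by fastforce
      then obtain p a b q where p: "w = p @ a # b # q" "length p = n"
        using word_split2 by blast
      then have "((a, b), (p, q)) \<in> ?S" using w by (cases a; cases b) (auto simp: cuts_def)
      then show "w \<in> ?h ` ?S" using p(1) by (force intro: rev_image_eqI)
    qed
  qed
  ultimately have "(\<Sum>w\<in>words f g. G w) = (\<Sum>z\<in>?S. G (?h z))"
    using sum.reindex[of ?h ?S G] by simp
  also have "\<dots> = (\<Sum>c\<in>?U. \<Sum>z\<in>(case c of (a, b) \<Rightarrow> cuts f g n a b). G (?h (c, z)))"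
    by (subst sum.Sigma) (auto simp: finite_cuts case_prod_unfold)
  also have "\<dots> = (\<Sum>(x, y)\<in>cuts f g n A A. G (x @ A # A # y))
    + (\<Sum>(x, y)\<in>cuts f g n A B. G (x @ A # B # y)) + (\<Sum>(x, y)\<in>cuts f g n B A. G (x @ B # A # y))
    + (\<Sum>(x, y)\<in>cuts f g n B B. G (x @ B # B # y))"
    by (simp add: case_prod_unfold)
  finally show ?thesis .
qed

text \<open>Terms with closed \<open>x\<close> vanish. The others are parametrised by the last
  unmatched B of \<open>x\<close>, and turning that B into an A while the pair AA becomes BA
  regroups them by the word to which the generator sends them.\<close>

lemma sum_s_op_AA:
  fixes \<mu> f g n
  assumes "length \<mu> = f + g"
  defines "C \<equiv> \<lambda>w. (of_int (coeff [] w \<mu>) :: rat)"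
  shows "(\<Sum>(x, y)\<in>cuts f g n A A.
      weight f g (x @ A # A # y) * of_int (s_op (Suc n) (coeff [] (x @ A # A # y)) \<mu>))
    = (\<Sum>(x, y)\<in>cuts f g n B A.
        (\<Sum>(u, v)\<in>lsplits x. weight f g (u @ B # v @ A # A # y)) * C (x @ B # A # y))"
proof -
  let ?G = "\<lambda>(x, y). weight f g (x @ A # A # y) * of_int (s_op (Suc n) (coeff [] (x @ A # A # y)) \<mu>)"
  define T where "T = {(u, v, y). length u + Suc (length v) = n \<and> bal v
    \<and> u @ B # v @ A # A # y \<in> words f g}"
  let ?h = "\<lambda>(u, v, y). (u @ B # v, y)"
  have sub: "?h ` T \<subseteq> cuts f g n A A" by (auto simp: T_def cuts_def)
  have inj: "inj_on ?h T"
    unfolding inj_on_def T_def by (auto dest: last_open_unique)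
  have zero: "?G z = 0" if z: "z \<in> cuts f g n A A - ?h ` T" for z
  proof -
    obtain x y where xy: "z = (x, y)" "length x = n" "x @ A # A # y \<in> words f g"
      using z by (auto simp: cuts_def)
    have "\<not> (\<exists>u v. x = u @ B # v \<and> bal v)"
    proof
      assume "\<exists>u v. x = u @ B # v \<and> bal v"
      then obtain u v where "x = u @ B # v" "bal v" by blast
      then have "(u, v, y) \<in> T" "z = ?h (u, v, y)" using xy by (auto simp: T_def)
      then show False using z by blast
    qed
    then have "closed_word x" using split_last_open by blast
    then show ?thesis
      using s_op_AA_closed[of x \<mu> y] xy assms(1) length_words[OF xy(3)] by simp
  qed
  have "(\<Sum>z\<in>cuts f g n A A. ?G z) = (\<Sum>z\<in>?h ` T. ?G z)"
    by (rule sum.mono_neutral_right[OF finite_cuts sub]) (use zero in blast)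
  also have "\<dots> = (\<Sum>z\<in>T. ?G (?h z))"
    unfolding sum.reindex[OF inj] by simp
  also have "\<dots> = (\<Sum>(u, v, y)\<in>T. weight f g (u @ B # v @ A # A # y) * C (u @ A # v @ B # A # y))"
  proof (rule sum.cong[OF refl])
    fix z assume "z \<in> T"
    then obtain u v y where z: "z = (u, v, y)" "length u + Suc (length v) = n" "bal v"
      "u @ B # v @ A # A # y \<in> words f g" by (auto simp: T_def)
    then show "?G (?h z)
      = (case z of (u, v, y) \<Rightarrow> weight f g (u @ B # v @ A # A # y) * C (u @ A # v @ B # A # y))"
      using s_op_AA[of v \<mu> u y] assms(1) length_words[OF z(4)] by (simp add: C_def)
  qed
  also have "\<dots> = (\<Sum>((x, y), (u, v))\<in>Sigma (cuts f g n B A) (\<lambda>(x, y). lsplits x).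
      weight f g (u @ B # v @ A # A # y) * C (x @ B # A # y))"
    by (rule sum.reindex_bij_witness[where
          i = "\<lambda>((x, y), (u, v)). (u, v, y)" and j = "\<lambda>(u, v, y). ((u @ A # v, y), (u, v))"])
      (auto simp: T_def cuts_def lsplits_def words_def)
  also have "\<dots> = (\<Sum>z\<in>cuts f g n B A. \<Sum>(u, v)\<in>(case z of (x, y) \<Rightarrow> lsplits x).
      weight f g (u @ B # v @ A # A # snd z) * C (fst z @ B # A # snd z))"
    by (subst sum.Sigma) (auto simp: finite_cuts finite_splits case_prod_unfold)
  also have "\<dots> = (\<Sum>(x, y)\<in>cuts f g n B A.
        (\<Sum>(u, v)\<in>lsplits x. weight f g (u @ B # v @ A # A # y)) * C (x @ B # A # y))"
    by (simp add: sum_distrib_right case_prod_unfold)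
  finally show ?thesis .
qed

lemma sum_s_op_BB:
  fixes \<mu> f g n
  assumes "length \<mu> = f + g"
  defines "C \<equiv> \<lambda>w. (of_int (coeff [] w \<mu>) :: rat)"
  shows "(\<Sum>(x, y)\<in>cuts f g n B B.
      weight f g (x @ B # B # y) * of_int (s_op (Suc n) (coeff [] (x @ B # B # y)) \<mu>))
    = (\<Sum>(x, y)\<in>cuts f g n B A.
        (\<Sum>(v, u)\<in>rsplits y. weight f g (x @ B # B # v @ A # u)) * C (x @ B # A # y))"
proof -
  let ?G = "\<lambda>(x, y). weight f g (x @ B # B # y) * of_int (s_op (Suc n) (coeff [] (x @ B # B # y)) \<mu>)"
  define T where "T = {(x, v, u). length x = n \<and> bal v \<and> x @ B # B # v @ A # u \<in> words f g}"
  let ?h = "\<lambda>(x, v, u). (x, v @ A # u)"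
  have sub: "?h ` T \<subseteq> cuts f g n B B" by (auto simp: T_def cuts_def)
  have inj: "inj_on ?h T"
    unfolding inj_on_def T_def by (auto dest: first_close_unique)
  have zero: "?G z = 0" if z: "z \<in> cuts f g n B B - ?h ` T" for z
  proof -
    obtain x y where xy: "z = (x, y)" "length x = n" "x @ B # B # y \<in> words f g"
      using z by (auto simp: cuts_def)
    have "\<not> (\<exists>v u. y = v @ A # u \<and> bal v)"
    proof
      assume "\<exists>v u. y = v @ A # u \<and> bal v"
      then obtain v u where "y = v @ A # u" "bal v" by blast
      then have "(x, v, u) \<in> T" "z = ?h (x, v, u)" using xy by (auto simp: T_def)
      then show False using z by blast
    qed
    then have "open_word y" using split_first_close by blast
    then show ?thesis
      using s_op_BB_open[of y \<mu> x] xy assms(1) length_words[OF xy(3)] by simp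
  qed
  have "(\<Sum>z\<in>cuts f g n B B. ?G z) = (\<Sum>z\<in>?h ` T. ?G z)"
    by (rule sum.mono_neutral_right[OF finite_cuts sub]) (use zero in blast)
  also have "\<dots> = (\<Sum>z\<in>T. ?G (?h z))"
    unfolding sum.reindex[OF inj] by simp
  also have "\<dots> = (\<Sum>(x, v, u)\<in>T. weight f g (x @ B # B # v @ A # u) * C (x @ B # A # v @ B # u))"
  proof (rule sum.cong[OF refl])
    fix z assume "z \<in> T"
    then obtain x v u where z: "z = (x, v, u)" "length x = n" "bal v"
      "x @ B # B # v @ A # u \<in> words f g" by (auto simp: T_def)
    then show "?G (?h z)
      = (case z of (x, v, u) \<Rightarrow> weight f g (x @ B # B # v @ A # u) * C (x @ B # A # v @ B # u))"
      using s_op_BB[of v \<mu> x u] assms(1) length_words[OF z(4)] by (simp add: C_def)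
  qed
  also have "\<dots> = (\<Sum>((x, y), (v, u))\<in>Sigma (cuts f g n B A) (\<lambda>(x, y). rsplits y).
      weight f g (x @ B # B # v @ A # u) * C (x @ B # A # y))"
    by (rule sum.reindex_bij_witness[where
          i = "\<lambda>((x, y), (v, u)). (x, v, u)" and j = "\<lambda>(x, v, u). ((x, v @ B # u), (v, u))"])
      (auto simp: T_def cuts_def rsplits_def words_def)
  also have "\<dots> = (\<Sum>z\<in>cuts f g n B A. \<Sum>(v, u)\<in>(case z of (x, y) \<Rightarrow> rsplits y).
      weight f g (fst z @ B # B # v @ A # u) * C (fst z @ B # A # snd z))"
    by (subst sum.Sigma) (auto simp: finite_cuts finite_splits case_prod_unfold)
  also have "\<dots> = (\<Sum>(x, y)\<in>cuts f g n B A.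
        (\<Sum>(v, u)\<in>rsplits y. weight f g (x @ B # B # v @ A # u)) * C (x @ B # A # y))"
    by (simp add: sum_distrib_right case_prod_unfold)
  finally show ?thesis .
qed

text \<open>All contributions land on words \<open>x @ B # A # y\<close>, and the total coefficient
  of each is the difference of the two sides of \<open>weight_identity\<close>.\<close>

lemma sum_sop_zero:
  assumes "n + 2 \<le> f + g" "length \<mu> = f + g"
  shows "(\<Sum>w\<in>words f g. weight f g w * of_int (s_op (Suc n) (coeff [] w) \<mu>)) = 0"
proof -
  let ?C = "\<lambda>w. (of_int (coeff [] w \<mu>) :: rat)"
  have AB: "(\<Sum>(x, y)\<in>cuts f g n A B.
      weight f g (x @ A # B # y) * of_int (s_op (Suc n) (coeff [] (x @ A # B # y)) \<mu>))
    = (\<Sum>(x, y)\<in>cuts f g n B A. weight f g (x @ A # B # y) * ?C (x @ B # A # y))"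
  proof (rule sum.cong)
    show "cuts f g n A B = cuts f g n B A" by (auto simp: cuts_def words_def)
    fix z assume "z \<in> cuts f g n B A"
    then obtain x y where z: "z = (x, y)" "length x = n" "x @ B # A # y \<in> words f g"
      by (auto simp: cuts_def)
    then show "(case z of (x, y) \<Rightarrow>
        weight f g (x @ A # B # y) * of_int (s_op (Suc n) (coeff [] (x @ A # B # y)) \<mu>))
      = (case z of (x, y) \<Rightarrow> weight f g (x @ A # B # y) * ?C (x @ B # A # y))"
      using s_op_AB[of \<mu> x y] assms(2) length_words[OF z(3)] by simp
  qed
  have BA: "(\<Sum>(x, y)\<in>cuts f g n B A.
      weight f g (x @ B # A # y) * of_int (s_op (Suc n) (coeff [] (x @ B # A # y)) \<mu>))
    = (\<Sum>(x, y)\<in>cuts f g n B A. - 2 * weight f g (x @ B # A # y) * ?C (x @ B # A # y))"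
  proof (rule sum.cong[OF refl])
    fix z assume "z \<in> cuts f g n B A"
    then obtain x y where z: "z = (x, y)" "length x = n" "x @ B # A # y \<in> words f g"
      by (auto simp: cuts_def)
    then show "(case z of (x, y) \<Rightarrow>
        weight f g (x @ B # A # y) * of_int (s_op (Suc n) (coeff [] (x @ B # A # y)) \<mu>))
      = (case z of (x, y) \<Rightarrow> - 2 * weight f g (x @ B # A # y) * ?C (x @ B # A # y))"
      using s_op_BA[of \<mu> x y] assms(2) length_words[OF z(3)] by simp
  qed
  have "(\<Sum>w\<in>words f g. weight f g w * of_int (s_op (Suc n) (coeff [] w) \<mu>))
    = (\<Sum>(x, y)\<in>cuts f g n B A.
        ((\<Sum>(u, v)\<in>lsplits x. weight f g (u @ B # v @ A # A # y))
         + weight f g (x @ A # B # y) - 2 * weight f g (x @ B # A # y)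
         + (\<Sum>(v, u)\<in>rsplits y. weight f g (x @ B # B # v @ A # u))) * ?C (x @ B # A # y))"
    unfolding sum_words_cuts[OF assms(1)]
    unfolding sum_s_op_AA[OF assms(2)] sum_s_op_BB[OF assms(2)] AB BA
    unfolding case_prod_unfold sum.distrib[symmetric]
    by (rule sum.cong[OF refl]) (simp add: algebra_simps)
  also have "\<dots> = 0"
  proof (rule sum.neutral, rule ballI)
    fix z assume "z \<in> cuts f g n B A"
    then obtain x y where z: "z = (x, y)" "x @ B # A # y \<in> words f g"
      by (auto simp: cuts_def)
    show "(case z of (x, y) \<Rightarrow> ((\<Sum>(u, v)\<in>lsplits x. weight f g (u @ B # v @ A # A # y))
         + weight f g (x @ A # B # y) - 2 * weight f g (x @ B # A # y)
         + (\<Sum>(v, u)\<in>rsplits y. weight f g (x @ B # B # v @ A # u))) * ?C (x @ B # A # y)) = 0"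
      using weight_identity[OF z(2)] z(1) by simp
  qed
  finally show ?thesis .
qed

section \<open>Words of partitions\<close>

text \<open>The boundary path of the partition: the r-th letter B from the right has as many letters
  A to its left as the r-th part says. Hence the largest part belongs to the rightmost B.\<close>

fun word_of :: "nat \<Rightarrow> nat list \<Rightarrow> letter list" where
  "word_of f [] = replicate f A"
| "word_of f (l # ls) = word_of l ls @ B # replicate (f - l) A"

lemma Pfg_0: "Pfg f 0 = {[]}"
  by (auto simp: Pfg_def)

lemma Pfg_Cons: "l # ls \<in> Pfg f (Suc g) \<longleftrightarrow> l \<le> f \<and> ls \<in> Pfg l g"
  by (fastforce simp: Pfg_def)

lemma Pfg_mono: "l \<le> f \<Longrightarrow> ls \<in> Pfg l g \<Longrightarrow> ls \<in> Pfg f g"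
  by (fastforce simp: Pfg_def)

lemma word_of_words: "ls \<in> Pfg f g \<Longrightarrow> word_of f ls \<in> words f g"
proof (induction ls arbitrary: f g)
  case Nil
  then show ?case by (simp add: Pfg_def words_def)
next
  case (Cons l ls)
  then obtain g' where "g = Suc g'" by (cases g) (auto simp: Pfg_def)
  then show ?case using Cons by (fastforce simp: Pfg_Cons words_def)
qed

lemma word_of_widen:
  assumes "ls \<in> Pfg l g" "l \<le> f"
  shows "word_of f ls = word_of l ls @ replicate (f - l) A"
proof (cases ls)
  case Nil
  then show ?thesis using assms by (simp add: replicate_add[symmetric])
next
  case (Cons k ks)
  then have "k \<le> l" using assms by (simp add: Pfg_def)
  then show ?thesis using Cons assms by (simp add: replicate_add[symmetric])
qed

lemma word_of_bij: "bij_betw (word_of f) (Pfg f g) (words f g)"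
proof (induction g arbitrary: f)
  case 0
  have "words f 0 = {replicate f A}"
  proof
    show "words f 0 \<subseteq> {replicate f A}"
    proof
      fix w assume "w \<in> words f 0"
      then have "B \<notin> set w" "length w = f"
        using length_words by (auto simp: words_def count_list_0_iff)
      then have "\<forall>c\<in>set w. c = A" by (metis letter.exhaust)
      then show "w \<in> {replicate f A}" using replicate_length_same[of w A] \<open>length w = f\<close> by simp
    qed
  qed (simp add: words_def)
  then show ?case by (simp add: Pfg_0 bij_betw_def)
next
  case (Suc g)
  have last_B: "p = p' \<and> n = n'"
    if "p @ B # replicate n A = p' @ B # replicate n' A" for p p' n n'
  proof -
    have "replicate n A @ B # rev p = replicate n' A @ B # rev p'"
      using arg_cong[OF that, of rev] by simp
    then have "n = n'"
    proof (induction n arbitrary: n')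
      case 0 then show ?case by (cases n') auto
    next
      case (Suc n) then show ?case by (cases n') auto
    qed
    then show ?thesis using that by simp
  qed
  have inj: "inj_on (word_of f) (Pfg f (Suc g))"
  proof (rule inj_onI)
    fix xs ys assume xs: "xs \<in> Pfg f (Suc g)" and ys: "ys \<in> Pfg f (Suc g)" and eq: "word_of f xs = word_of f ys"
    obtain l ls k ks where c: "xs = l # ls" "ys = k # ks"
      using xs ys by (cases xs; cases ys) (auto simp: Pfg_def)
    have "word_of l ls = word_of k ks \<and> f - l = f - k" using eq c last_B[of "word_of l ls" "f - l" "word_of k ks" "f - k"] by simp
    moreover have "l \<le> f" "k \<le> f" "ls \<in> Pfg l g" "ks \<in> Pfg k g" using xs ys c by (auto simp: Pfg_Cons)
    moreover from calculation have "l = k" by linarith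
    ultimately have "ls = ks"
      using inj_onD[OF bij_betw_imp_inj_on[OF Suc.IH[of l]], of ls ks] by simp
    then show "xs = ys" using c \<open>l = k\<close> by simp
  qed
  have "words f (Suc g) \<subseteq> word_of f ` Pfg f (Suc g)"
  proof
    fix w assume w: "w \<in> words f (Suc g)"
    then have "B \<in> set w" using count_list_0_iff[of w B] by (auto simp: words_def)
    then obtain p q where pq: "w = p @ B # q" "B \<notin> set q" by (metis split_list_last)
    have "\<forall>c\<in>set q. c = A" using pq(2) by (metis letter.exhaust)
    then have q: "q = replicate (length q) A" using replicate_length_same by metis
    have cq: "count_list q A = length q" "count_list q B = 0"
      by (subst q, simp)+
    have "p \<in> words (f - length q) g" "length q \<le> f"
      using w pq cq by (auto simp: words_def)
    then obtain ls where ls: "ls \<in> Pfg (f - length q) g" "p = word_of (f - length q) ls"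
      using bij_betw_imp_surj_on[OF Suc.IH[of "f - length q"]] by blast
    have "(f - length q) # ls \<in> Pfg f (Suc g)" using ls by (simp add: Pfg_Cons)
    moreover have "word_of f ((f - length q) # ls) = w"
      using ls pq q[symmetric] \<open>length q \<le> f\<close> by simp
    ultimately show "w \<in> word_of f ` Pfg f (Suc g)" by (metis image_eqI)
  qed
  then show ?case using inj word_of_words by (auto simp: bij_betw_def)
qed

lemma tword_0: "tword f 0 ls = []"
  by (simp add: tword_def)

lemma tword_Cons: "tword f (Suc g) (l # ls) = [l + Suc g ..< f + Suc g] @ tword f g ls"
proof -
  have "[1..<Suc g + 1] = 1 # map Suc [1..<g + 1]"
    unfolding map_Suc_upt by (subst upt_conv_Cons) auto
  then show ?thesis unfolding tword_def
    by (simp add: comp_def nth_Cons' del: upt_Suc) (intro arg_cong[of _ _ concat] map_cong, auto)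
qed

text \<open>Reading \<open>tword\<close> from right to left moves the letters B to the left, each step
  replacing a factor AB by BA.\<close>

lemma tword_induct:
  assumes "ls \<in> Pfg f g"
    and base: "Q [] (replicate f A @ replicate g B)"
    and step: "\<And>ws x y. Q ws (x @ A # B # y) \<Longrightarrow> Q (Suc (length x) # ws) (x @ B # A # y)"
  shows "Q (tword f g ls) (word_of f ls)"
proof -
  have push: "Q ([Suc (length x) ..< Suc (length x) + n] @ ws) (x @ B # replicate n A @ y)"
    if "Q ws (x @ replicate n A @ B # y)" for n x y ws
    using that
  proof (induction n arbitrary: ws y)
    case 0
    then show ?case by simp
  next
    case (Suc n)
    have "Q ws ((x @ replicate n A) @ A # B # y)"
      using Suc.prems by (simp add: replicate_append_same[symmetric])
    then have "Q (Suc (length x + n) # ws) (x @ replicate n A @ B # A # y)"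
      using step[of ws "x @ replicate n A" y] by simp
    then show ?case using Suc.IH[of "Suc (length x + n) # ws" "A # y"]
      by (simp add: replicate_app_Cons_same)
  qed
  \<comment> \<open>Generalised to the last h parts: their letters B have already moved, while the j
    letters B of the larger parts still stand at the right end.\<close>
  have "Q (tword f h ls) (word_of f ls @ replicate j B)" if "ls \<in> Pfg f h" "g = h + j" for h j
    using that
  proof (induction ls arbitrary: h j)
    case Nil
    then show ?case using base by (simp add: Pfg_def tword_0)
  next
    case (Cons l ls)
    then obtain h' where h: "h = Suc h'" by (cases h) (auto simp: Pfg_def)
    then have l: "l \<le> f" "ls \<in> Pfg l h'" using Cons.prems by (auto simp: Pfg_Cons)
    have "Q (tword f h' ls) (word_of f ls @ replicate (Suc j) B)"
      using Cons.IH[of h' "Suc j"] Pfg_mono[OF l] Cons.prems h by simp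
    then have "Q (tword f h' ls) (word_of l ls @ replicate (f - l) A @ B # replicate j B)"
      using word_of_widen[OF l(2,1)] by simp
    moreover have "length (word_of l ls) = l + h'" using word_of_words[OF l(2)] length_words by blast
    moreover have "Suc (l + h') + (f - l) = f + Suc h'" using l(1) by simp
    ultimately show ?case using push[of "tword f h' ls" "word_of l ls" "f - l" "replicate j B"] l(1) h
      by (simp add: tword_Cons add.commute[of h' f] del: upt_Suc)
  qed
  from this[of g 0] assms(1) show ?thesis by simp
qed

section \<open>The function F as a hook quotient\<close>

lemma bal_nest: "bal v \<Longrightarrow> bal (replicate n B @ v @ replicate n A)"
proof (induction n)
  case 0
  then show ?case by simp
next
  case (Suc n)
  then show ?case using bal_wrap[of "replicate n B @ v @ replicate n A"]
    by (simp add: replicate_append_same)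
qed

text \<open>The n surrounding chords have half-lengths \<open>half v + 1\<close>, ...,
  \<open>half v + n\<close>. The quotient of factorials is stated without division.\<close>

lemma hook_nest:
  assumes "bal v"
  shows "fact (half v) * hook (replicate n B @ v @ replicate n A) = hook v * fact (half v + n)"
proof (induction n)
  case 0
  then show ?case by simp
next
  case (Suc n)
  have "hook (replicate (Suc n) B @ v @ replicate (Suc n) A)
      = Suc (half v + n) * hook (replicate n B @ v @ replicate n A)"
    using hook_wrap[OF bal_nest[OF assms, of n]] by (simp add: replicate_append_same)
  then have "fact (half v) * hook (replicate (Suc n) B @ v @ replicate (Suc n) A)
      = Suc (half v + n) * (fact (half v) * hook (replicate n B @ v @ replicate n A))"
    by (simp only: ac_simps)
  then show ?case unfolding Suc by (simp add: algebra_simps)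
qed

lemma ht_ge_length: "ht p \<ge> - int (length p)"
  by (induction p rule: ht.induct) auto

text \<open>The path has its low points at the end and just before a letter B. Before the B of the
  part with index i the height is h - (i + 1 + \<open>ls ! i\<close>), so bounding row plus part
  bounds the depth.\<close>

lemma word_of_prefix_ht:
  assumes "ls \<in> Pfg n h" "n \<le> s" "\<And>i. i < h \<Longrightarrow> ls ! i + i + 1 \<le> s" "word_of n ls = p @ q"
  shows "ht p \<ge> int h - int s"
  using assms
proof (induction ls arbitrary: n h s p q)
  case Nil
  have "h = 0" using Nil.prems(1) by (simp add: Pfg_def)
  moreover have "length p \<le> n" using arg_cong[OF Nil.prems(4), of length] by simp
  ultimately show ?case using ht_ge_length[of p] Nil.prems(2) by simp
next
  case (Cons l ls)
  then obtain h' where h: "h = Suc h'" by (cases h) (auto simp: Pfg_def)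
  then have l: "l \<le> n" "ls \<in> Pfg l h'" using Cons.prems(1) by (auto simp: Pfg_Cons)
  have ls: "l + 1 \<le> s" using Cons.prems(3)[of 0] h by simp
  have ht_word_of: "ht (word_of l ls) = int h' - int l"
    using word_of_words[OF l(2)] by (simp add: words_def ht_count)
  from Cons.prems(4) consider us where "word_of l ls = p @ us"
    | us where "p = word_of l ls @ us" "B # replicate (n - l) A = us @ q"
    unfolding word_of.simps append_eq_append_conv2 by blast
  then show ?case
  proof cases
    case 1
    have "ls ! i + i + 1 \<le> s - 1" if "i < h'" for i
      using Cons.prems(3)[of "Suc i"] that h by simp
    then have "ht p \<ge> int h' - int (s - 1)"
      using Cons.IH[OF l(2) _ _ 1, of "s - 1"] ls by simp
    then show ?thesis using h ls by simp
  next
    case 2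
    show ?thesis
    proof (cases us)
      case Nil
      then show ?thesis using 2 ht_word_of ls h by simp
    next
      case (Cons c us')
      have "length us \<le> Suc (n - l)" using arg_cong[OF 2(2), of length] by simp
      then have "c = B" "length us' \<le> n - l" using 2(2) Cons by auto
      then show ?thesis using 2 Cons ht_word_of ht_ge_length[of us'] l(1) h \<open>n \<le> s\<close> by simp
    qed
  qed
qed

lemma word_of_bal:
  assumes "ls \<in> Pfg n h" "h \<le> n" "\<And>i. i < h \<Longrightarrow> ls ! i + i + 1 \<le> n"
  shows "bal (replicate (n - h) B @ word_of n ls)" "half (replicate (n - h) B @ word_of n ls) = n"
proof -
  have w: "word_of n ls \<in> words n h" using word_of_words[OF assms(1)] .
  then show "half (replicate (n - h) B @ word_of n ls) = n" by (simp add: half_def words_def)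
  show "bal (replicate (n - h) B @ word_of n ls)"
  proof (rule bal_if_heights)
    show "ht (replicate (n - h) B @ word_of n ls) = 0"
      using w assms(2) by (simp add: ht_count[of "word_of n ls"] words_def)
    fix p q assume "replicate (n - h) B @ word_of n ls = p @ q"
    then consider us where "replicate (n - h) B = p @ us"
      | us where "p = replicate (n - h) B @ us" "word_of n ls = us @ q"
      unfolding append_eq_append_conv2 by blast
    then show "ht p \<ge> 0"
    proof cases
      case 1
      then have "set p \<subseteq> {B}" by (metis Un_subset_iff set_append set_replicate_conv_if subset_insertI
            empty_subsetI order_refl)
      then have "A \<notin> set p" by auto
      then show ?thesis by (simp add: ht_count)
    next
      case 2
      then have "ht us \<ge> int h - int n"
        using word_of_prefix_ht[OF assms(1) order_refl assms(3) 2(2)] by blast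
      then show ?thesis using 2(1) assms(2) by simp
    qed
  qed
qed

lemma word_of_append:
  assumes "ys \<in> Pfg b h" "b \<le> f" "\<And>x. x \<in> set xs \<Longrightarrow> b \<le> x"
  shows "word_of f (xs @ ys) = word_of b ys @ word_of (f - b) (map (\<lambda>x. x - b) xs)"
  using assms(2,3)
proof (induction xs arbitrary: f)
  case Nil
  then show ?case using word_of_widen[OF assms(1), of f] by simp
next
  case (Cons x xs)
  then show ?case by simp
qed

lemma word_of_zeros: "word_of f (replicate g 0) = replicate g B @ replicate f A"
proof (induction g arbitrary: f)
  case 0
  then show ?case by simp
next
  case (Suc g)
  then show ?case by (simp add: replicate_app_Cons_same)
qed

lemma zeros_Pfg: "replicate g 0 \<in> Pfg f g"
  by (simp add: Pfg_def sorted_wrt_iff_nth_less)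

lemma Fnode_max:
  assumes "1 \<le> i" "i \<le> length xs" "0 < xs ! (i - 1)"
  shows "i + xs ! (i - 1) \<le> Fnode xs + xs ! (Fnode xs - 1)"
proof -
  have "\<forall>y. (1 \<le> y \<and> y \<le> length xs \<and> 0 < xs ! (y - 1)) \<longrightarrow>
      y + xs ! (y - 1) < Suc (length xs + sum_list xs)"
  proof (intro allI impI)
    fix y assume y: "1 \<le> y \<and> y \<le> length xs \<and> 0 < xs ! (y - 1)"
    then have "xs ! (y - 1) \<le> sum_list xs" by (intro elem_le_sum_list) linarith
    then show "y + xs ! (y - 1) < Suc (length xs + sum_list xs)" using y by simp
  qed
  then show ?thesis unfolding Fnode_def
    using arg_max_nat_le[where P = "\<lambda>i. 1 \<le> i \<and> i \<le> length xs \<and> 0 < xs ! (i - 1)" and x = i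
        and f = "\<lambda>i. i + xs ! (i - 1)"] assms by blast
qed

text \<open>The node chosen in the recursion of \<open>Fpart\<close> cuts the completed word at its top level
  into two balanced words.\<close>

lemma Fpart_hook:
  assumes "ls \<in> Pfg f g"
  shows "Fpart ls * hook (replicate f B @ word_of f ls @ replicate g A) = fact (f + g)"
  using assms
proof (induction ls arbitrary: f g rule: measure_induct_rule[of sum_list])
  case (less ls)
  have len: "length ls = g" and le_f: "\<And>x. x \<in> set ls \<Longrightarrow> x \<le> f"
    and dec: "\<And>i j. i \<le> j \<Longrightarrow> j < g \<Longrightarrow> ls ! j \<le> ls ! i"
    using less.prems by (auto simp: Pfg_def sorted_wrt_iff_nth_less le_less)
  show ?case
  proof (cases "\<forall>x\<in>set ls. x = 0")
    case True
    then have "ls = replicate g 0" using len replicate_length_same by metis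
    moreover have "Fpart ls = 1" using True by (subst Fpart.simps) simp
    moreover have "replicate f B @ (replicate g B @ replicate f A) @ replicate g A
        = replicate (f + g) B @ [] @ replicate (f + g) A" by (simp add: replicate_add)
    ultimately show ?thesis using hook_nest[OF bal_Nil, of "f + g"] by (simp only: word_of_zeros) simp
  next
    case False
    define a b where "a = Fnode ls" and "b = ls ! (a - 1)"
    have a: "1 \<le> a" "a \<le> g" "0 < b" using Fnode_props[OF False] len by (auto simp: a_def b_def)
    have mx: "i + ls ! (i - 1) \<le> a + b" if "1 \<le> i" "i \<le> g" "0 < ls ! (i - 1)" for i
      using Fnode_max[of i ls] that len by (simp add: a_def b_def)
    have bf: "b \<le> f" using le_f[of b] a len by (simp add: b_def)
    have F: "Fpart ls = ((a + b) choose a) * Fpart (drop a ls) * Fpart (map (\<lambda>x. x - b) ls)"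
      unfolding a_def b_def by (subst Fpart.simps) (simp only: False Let_def if_False)

    define ys where "ys = drop a ls"
    have lys: "length ys = g - a" and nys: "\<And>i. i < g - a \<Longrightarrow> ys ! i = ls ! (a + i)"
      using len a by (auto simp: ys_def)
    have ys: "ys \<in> Pfg b (g - a)"
    proof -
      have "ys ! j \<le> ys ! i" if "i < j" "j < g - a" for i j using that nys dec by simp
      moreover have "ys ! i \<le> b" if "i < g - a" for i using that nys dec[of "a - 1" "a + i"] a
        by (simp add: b_def)
      ultimately show ?thesis using lys
        by (auto simp: Pfg_def sorted_wrt_iff_nth_less in_set_conv_nth)
    qed
    \<comment> \<open>The choice of the node bounds row plus part only for nonzero parts. The zero
      parts are initial letters B of the word, so they are split off and join the padding.\<close>
    define \<rho> where "\<rho> = takeWhile (\<lambda>x. x > 0) ys"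
    define c where "c = length \<rho>"
    have c_le: "c \<le> g - a" using lys length_takeWhile_le[of "\<lambda>x. x > 0" ys] by (simp add: c_def \<rho>_def)
    have n\<rho>: "\<rho> ! i = ls ! (a + i)" "0 < \<rho> ! i" if "i < c" for i
    proof -
      have "\<rho> ! i = ys ! i" using that by (simp add: c_def \<rho>_def takeWhile_nth)
      then show "\<rho> ! i = ls ! (a + i)" using nys that c_le by simp
      show "0 < \<rho> ! i" using that set_takeWhileD[of "\<rho> ! i" "\<lambda>x. x > 0" ys]
        by (auto simp: c_def \<rho>_def)
    qed
    have cond: "\<rho> ! i + i + 1 \<le> b" if "i < c" for i
    proof -
      have "a + i + 1 \<le> g" using that c_le by simp
      then show ?thesis using mx[of "a + i + 1"] n\<rho>[OF that] by simp
    qed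
    have cb: "c \<le> b"
    proof (cases c)
      case (Suc c')
      then show ?thesis using cond[of c'] n\<rho>(2)[of c'] by simp
    qed simp
    have ys_eq: "ys = \<rho> @ replicate (g - a - c) 0"
    proof -
      have "ys ! i = 0" if "c \<le> i" "i < g - a" for i
      proof -
        have "\<not> 0 < ys ! c"
          using nth_length_takeWhile[of "\<lambda>x. x > 0" ys] that lys by (simp add: c_def \<rho>_def)
        then show ?thesis using dec[of "a + c" "a + i"] nys that by simp
      qed
      then show ?thesis
        using lys c_le by (intro nth_equalityI)
          (auto simp: nth_append c_def[symmetric] nys n\<rho>)
    qed
    have \<rho>P: "\<rho> \<in> Pfg b c"
      using ys ys_eq by (auto simp: Pfg_def c_def sorted_wrt_append)
    define V where "V = replicate (b - c) B @ word_of b \<rho>"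
    have V: "bal V" "half V = b" using word_of_bal[OF \<rho>P cb cond] by (simp_all add: V_def)
    have wdys: "word_of b ys = replicate (g - a - c) B @ word_of b \<rho>"
      using word_of_append[OF zeros_Pfg[of "g - a - c" 0], of b \<rho>] ys_eq word_of_zeros[of 0] by simp
    have BV: "replicate b B @ word_of b ys = replicate (g - a) B @ V"
      unfolding wdys V_def append_assoc[symmetric] replicate_add[symmetric] using cb c_le by simp

    define xs where "xs = take a ls"
    have lxs: "length xs = a" "\<And>i. i < a \<Longrightarrow> xs ! i = ls ! i" using len a by (auto simp: xs_def)
    have xs_ge: "b \<le> x" if "x \<in> set xs" for x
      using that dec[of _ "a - 1"] lxs a by (auto simp: in_set_conv_nth b_def)
    define \<kappa> where "\<kappa> = map (\<lambda>x. x - b) xs"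
    have n\<kappa>: "\<kappa> ! i = ls ! i - b" if "i < a" for i using that lxs by (simp add: \<kappa>_def)
    have cond\<kappa>: "\<kappa> ! i + i + 1 \<le> a" if "i < a" for i
    proof -
      have "b \<le> ls ! i" using xs_ge[OF nth_mem, of i] lxs that by simp
      then show ?thesis using mx[of "Suc i"] n\<kappa>[OF that] that a by simp
    qed
    \<comment> \<open>The entries of \<open>\<kappa>\<close> are at most a by maximality of the node
      and at most f - b by the width of the partition, and either bound may be the smaller.
      \<open>U\<close> is written with width a, and \<open>QU\<close> exchanges the two widths
      through trailing letters A.\<close>
    define l where "l = min a (f - b)"
    have \<kappa>P: "\<kappa> \<in> Pfg l a"
    proof -
      have "\<kappa> ! j \<le> \<kappa> ! i" if "i < j" "j < a" for i j
        using that n\<kappa> dec[of i j] a by (simp add: diff_le_mono)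
      moreover have "\<kappa> ! i \<le> l" if "i < a" for i
        using that n\<kappa>[OF that] cond\<kappa>[OF that] le_f[of "ls ! i"] a len by (auto simp: l_def)
      moreover have "length \<kappa> = a" using lxs by (simp add: \<kappa>_def)
      ultimately show ?thesis by (auto simp: Pfg_def sorted_wrt_iff_nth_less in_set_conv_nth)
    qed
    define U where "U = word_of a \<kappa>"
    have la: "l \<le> a" "l \<le> f - b" by (simp_all add: l_def)
    have U: "bal U" "half U = a"
      using word_of_bal[OF Pfg_mono[OF la(1) \<kappa>P] order_refl cond\<kappa>] by (simp_all add: U_def)
    have QU: "word_of (f - b) \<kappa> @ replicate a A = U @ replicate (f - b) A"
    proof -
      have "f - b - l + a = a - l + (f - b)" using la by simp
      then show ?thesis unfolding U_def word_of_widen[OF \<kappa>P la(1)] word_of_widen[OF \<kappa>P la(2)]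
          append_assoc replicate_add[symmetric] by simp
    qed

    have ls_eq: "ls = xs @ ys" by (simp add: xs_def ys_def)
    have map_eq: "map (\<lambda>x. x - b) ls = \<kappa> @ replicate (g - a) 0"
    proof -
      have "map (\<lambda>x. x - b) ys = replicate (g - a) 0"
        using ys lys by (intro replicate_eqI) (auto simp: Pfg_def)
      then show ?thesis by (simp add: ls_eq \<kappa>_def)
    qed
    have map_P: "map (\<lambda>x. x - b) ls \<in> Pfg (f - b) g"
      using less.prems by (auto simp: Pfg_def sorted_wrt_map diff_le_mono
          intro: sorted_wrt_mono_rel[of _ "(\<ge>)"])

    have A_split: "replicate g A = replicate a A @ replicate (g - a) A"
      and B_split: "replicate f B = replicate (f - b) B @ replicate b B"
      using a bf by (simp_all add: replicate_add[symmetric])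
    have "Fpart ys * hook (replicate b B @ word_of b ys @ replicate (g - a) A) = fact (b + (g - a))"
      using less.IH[of ys b "g - a"] ys sum_list_drop_less[of a ls] a len
      by (simp add: ys_def b_def)
    then have "Fpart ys * hook (replicate (g - a) B @ V @ replicate (g - a) A) = fact (b + (g - a))"
      by (metis BV append_assoc)
    \<comment> \<open>The g - a chords around \<open>V\<close> contribute (b + g - a)!/b!, so the
      induction hypothesis reduces to a statement about \<open>V\<close> alone.\<close>
    then have "Fpart ys * (hook V * fact (b + (g - a))) = fact b * fact (b + (g - a))"
      using hook_nest[OF V(1), of "g - a"] V(2) by (metis mult.left_commute)
    then have FV: "Fpart ys * hook V = fact b" by simp

    have "word_of (f - b) (map (\<lambda>x. x - b) ls) = replicate (g - a) B @ word_of (f - b) \<kappa>"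
      unfolding map_eq using word_of_append[OF zeros_Pfg[of "g - a" 0], of "f - b" \<kappa>] word_of_zeros[of 0]
      by simp
    then have "replicate (f - b) B @ word_of (f - b) (map (\<lambda>x. x - b) ls) @ replicate g A
        = replicate (f - b) B @ replicate (g - a) B @ (word_of (f - b) \<kappa> @ replicate a A)
          @ replicate (g - a) A"
      by (simp add: A_split)
    also have "\<dots> = replicate (f - b + (g - a)) B @ U @ replicate (f - b + (g - a)) A"
      unfolding QU by (simp add: replicate_add)
    finally have W: "replicate (f - b) B @ word_of (f - b) (map (\<lambda>x. x - b) ls) @ replicate g A
        = replicate (f - b + (g - a)) B @ U @ replicate (f - b + (g - a)) A" .
    have "Fpart (map (\<lambda>x. x - b) ls)
        * hook (replicate (f - b + (g - a)) B @ U @ replicate (f - b + (g - a)) A) = fact (f - b + g)"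
      using less.IH[OF _ map_P] sum_list_minus_less[of b "a - 1" ls] a len W by (simp add: b_def)
    then have "fact a * fact (f - b + g) = Fpart (map (\<lambda>x. x - b) ls)
        * (fact a * hook (replicate (f - b + (g - a)) B @ U @ replicate (f - b + (g - a)) A))"
      by (simp only: mult.left_commute)
    also have "fact a * hook (replicate (f - b + (g - a)) B @ U @ replicate (f - b + (g - a)) A)
        = hook U * fact (a + (f - b + (g - a)))"
      using hook_nest[OF U(1), of "f - b + (g - a)"] unfolding U(2) .
    also have "a + (f - b + (g - a)) = f - b + g" using a by simp
    finally have "Fpart (map (\<lambda>x. x - b) ls) * (hook U * fact (f - b + g)) = fact a * fact (f - b + g)" ..
    then have FU: "Fpart (map (\<lambda>x. x - b) ls) * hook U = fact a" by simp

    have "word_of f ls = word_of b ys @ word_of (f - b) \<kappa>"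
      unfolding ls_eq \<kappa>_def using word_of_append[OF ys bf] xs_ge by blast
    then have "replicate f B @ word_of f ls @ replicate g A
      = replicate (f - b) B @ (replicate b B @ word_of b ys) @ (word_of (f - b) \<kappa> @ replicate a A)
        @ replicate (g - a) A"
      by (simp add: A_split B_split)
    also have "\<dots> = replicate (f - b + (g - a)) B @ (V @ U) @ replicate (f - b + (g - a)) A"
      unfolding BV QU by (simp add: replicate_add)
    finally have W': "replicate f B @ word_of f ls @ replicate g A
      = replicate (f - b + (g - a)) B @ (V @ U) @ replicate (f - b + (g - a)) A" .
    have "half (V @ U) = a + b" "a + b + (f - b + (g - a)) = f + g" using U(2) V(2) a bf by simp_all
    then have H: "fact (a + b) * hook (replicate f B @ word_of f ls @ replicate g A)
      = hook V * hook U * fact (f + g)"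
      using hook_nest[OF bal_append[OF V(1) U(1)], of "f - b + (g - a)"]
      unfolding W' hook_bal_append[OF V(1) U(1)] by (simp only:)
    \<comment> \<open>The chords around \<open>V @ U\<close> contribute (f + g)!/(a + b)!. With b!
      and a! for the two factors, this leaves exactly the binomial coefficient of the
      recursion.\<close>
    have "fact (a + b) * (Fpart ls * hook (replicate f B @ word_of f ls @ replicate g A))
      = Fpart ls * (hook V * hook U * fact (f + g))"
      unfolding H[symmetric] by (simp only: mult.left_commute)
    also have "\<dots> = ((a + b) choose a) * (Fpart ys * hook V) * (Fpart (map (\<lambda>x. x - b) ls) * hook U)
        * fact (f + g)"
      unfolding F ys_def by (simp only: ac_simps)
    also have "\<dots> = (fact a * fact b * ((a + b) choose a)) * fact (f + g)"
      unfolding FV FU by (simp only: ac_simps)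
    also have "fact a * fact b * ((a + b) choose a) = (fact (a + b) :: nat)"
      using binomial_fact_lemma[of a "a + b"] by simp
    finally show ?thesis by simp
  qed
qed

lemma Fpart_weight:
  assumes "ls \<in> Pfg f g"
  shows "of_nat (Fpart ls) = fact (f + g) * weight f g (word_of f ls)"
proof -
  have "hook (replicate f B @ word_of f ls @ replicate g A) \<noteq> 0" using hook_pos by (metis less_not_refl)
  moreover have "(of_nat (Fpart ls * hook (replicate f B @ word_of f ls @ replicate g A)) :: rat)
    = fact (f + g)" unfolding Fpart_hook[OF assms] by simp
  ultimately show ?thesis by (simp add: weight_def wt_def field_simps)
qed

section \<open>Extreme words and the normalising constant\<close>

lemma coeff_all_B: "length u = n \<Longrightarrow> coeff st (replicate n B) u
    = (if set st \<subseteq> {B} \<and> u = replicate n B then 1 else 0)"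
proof (induction n arbitrary: u st)
  case 0
  then show ?case by simp
next
  case (Suc n)
  then obtain a q where "u = a # q" "length q = n" by (cases u) auto
  then show ?case using Suc.IH[of q "a # st"] by auto
qed

lemma coeff_bottom_word:
  "length u = f + g \<Longrightarrow> coeff [] (replicate f A @ replicate g B) u
    = (if u = replicate f A @ replicate g B then 1 else 0)"
proof (induction f arbitrary: u)
  case 0
  then show ?case by (simp add: coeff_all_B)
next
  case (Suc f)
  then obtain a q where "u = a # q" "length q = f + g" by (cases u) auto
  then show ?case using Suc.IH[of q] by (cases a) auto
qed

text \<open>While the target still shows letters B, the stack holds only B, visible or not. An A in
  \<open>w\<close> at such a place gives the factor \<open>eps B B\<close>, which is 0.\<close>

lemma coeff_top_word:
  "w \<in> words f n \<Longrightarrow> coeff (replicate j B) w (replicate n B @ replicate f A)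
    = (if w = replicate n B @ replicate f A then 1 else 0)"
proof (induction n arbitrary: j w)
  case 0
  have w: "w = replicate f A"
    using 0 word_of_bij[of f 0] by (auto simp: bij_betw_def Pfg_0)
  have "coeff (replicate j B) (replicate f A) (replicate f A) = 1"
  proof (induction f arbitrary: j)
    case 0
    then show ?case by auto
  next
    case (Suc f)
    show ?case
    proof (cases j)
      case 0 then show ?thesis using Suc.IH[of 0] by simp
    next
      case (Suc j') then show ?thesis using Suc.IH[of j'] by simp
    qed
  qed
  then show ?case using w by simp
next
  case (Suc n)
  then obtain c w' where w: "w = c # w'" by (cases w) (auto simp: words_def)
  show ?case
  proof (cases c)
    case A
    then show ?thesis using w by (cases j) auto
  next
    case B
    then have "w' \<in> words f n" using Suc.prems w by (simp add: words_def)
    then show ?thesis using Suc.IH[of w' "Suc j"] w B by simp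
  qed
qed

text \<open>Annihilation makes the sum invariant under replacing AB by BA in the target, and
  \<open>tword_induct\<close> reaches every word from \<open>replicate f A @ replicate g B\<close>
  by such moves. The value is the weight of the word with all B in front, which completes to f + g
  nested chords.\<close>

lemma sum_weight_coeff:
  assumes "\<mu> \<in> words f g"
  shows "(\<Sum>w\<in>words f g. weight f g w * of_int (coeff [] w \<mu>)) = 1 / fact (f + g)"
proof -
  define R where "R \<mu> = (\<Sum>w\<in>words f g. weight f g w * of_int (coeff [] w \<mu>))" for \<mu>
  have inv: "R (x @ B # A # y) = R (x @ A # B # y)" if "length x + length y + 2 = f + g" for x y
  proof -
    have "(\<Sum>w\<in>words f g. weight f g w * of_int (s_op (Suc (length x)) (coeff [] w) (x @ A # B # y))) = 0"
      by (rule sum_sop_zero) (use that in auto)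
    then show ?thesis
      by (simp add: R_def s_op_def swap_append right_diff_distrib sum_subtractf)
  qed
  have word_of_R: "R (word_of f ls) = R (replicate f A @ replicate g B)" if "ls \<in> Pfg f g" for ls
  proof -
    have "length (word_of f ls) = f + g \<and> R (word_of f ls) = R (replicate f A @ replicate g B)"
      by (rule tword_induct[OF that, where Q = "\<lambda>ws w. length w = f + g
            \<and> R w = R (replicate f A @ replicate g B)"]) (auto simp: inv)
    then show ?thesis ..
  qed
  have R_const: "R w = R (replicate f A @ replicate g B)" if "w \<in> words f g" for w
    using that word_of_R bij_betw_imp_surj_on[OF word_of_bij[of f g]] by (metis imageE)
  let ?t = "replicate g B @ replicate f A"
  have t: "?t \<in> words f g" by (simp add: words_def)
  have "R ?t = (\<Sum>w\<in>words f g. if w = ?t then weight f g ?t else 0)"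
    unfolding R_def using coeff_top_word[of _ f g 0] by (intro sum.cong) auto
  also have "\<dots> = weight f g ?t" using t finite_words by simp
  also have "\<dots> = 1 / fact (f + g)"
  proof -
    have "replicate f B @ ?t @ replicate g A = replicate (f + g) B @ [] @ replicate (f + g) A"
      by (simp add: replicate_add)
    then show ?thesis using hook_nest[OF bal_Nil, of "f + g"]
      by (simp add: weight_def wt_def)
  qed
  finally show ?thesis using R_const[OF assms] R_const[OF t] by (simp add: R_def)
qed

text \<open>The rational weights scaled by (f + g)! become the integers F, and the identity between
  integers is valid in every characteristic.\<close>

lemma sum_Fpart_coeff:
  assumes "\<mu> \<in> words f g"
  shows "(\<Sum>ls\<in>Pfg f g. int (Fpart ls) * coeff [] (word_of f ls) \<mu>) = 1"
proof -
  have "(of_int (\<Sum>ls\<in>Pfg f g. int (Fpart ls) * coeff [] (word_of f ls) \<mu>) :: rat)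
    = (\<Sum>ls\<in>Pfg f g. fact (f + g) * (weight f g (word_of f ls) * of_int (coeff [] (word_of f ls) \<mu>)))"
    unfolding of_int_sum by (rule sum.cong) (auto simp: Fpart_weight)
  also have "\<dots> = fact (f + g) * (\<Sum>w\<in>words f g. weight f g w * of_int (coeff [] w \<mu>))"
    using sum.reindex_bij_betw[OF word_of_bij[of f g], of "\<lambda>w. weight f g w * of_int (coeff [] w \<mu>)"]
    by (simp add: sum_distrib_left[symmetric])
  also have "\<dots> = 1" unfolding sum_weight_coeff[OF assms] by simp
  finally show ?thesis by (metis of_int_eq_1_iff)
qed

section \<open>The permutation module\<close>

lemma swap_words:
  assumes "w \<in> words f g" "1 \<le> i" "i < f + g"
  shows "swap i w \<in> words f g" "swap i (swap i w) = w"
proof -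
  have "length w = (i - 1) + 2 + (f + g - i - 1)" using assms length_words[OF assms(1)] by simp
  then obtain p a b q where w: "w = p @ a # b # q" "length p = i - 1"
    using word_split2 by blast
  then have i: "i = Suc (length p)" using assms(2) by simp
  show "swap i w \<in> words f g" using assms(1) unfolding w(1) i swap_append by (auto simp: words_def)
  show "swap i (swap i w) = w" unfolding w(1) i swap_append ..
qed

lemma nth_swap_tgen:
  assumes "1 \<le> i" "i < length w" "1 \<le> j" "j \<le> length w"
  shows "swap i w ! (tgen i j - 1) = w ! (j - 1)"
  using assms by (auto simp: swap_def tgen_def transpose_def nth_list_update)

lemma tword_letters:
  assumes "ls \<in> Pfg f g"
  shows "set (tword f g ls) \<subseteq> {1..<f + g}"
proof -
  have "length (word_of f ls) = f + g \<and> set (tword f g ls) \<subseteq> {1..<f + g}"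
    by (rule tword_induct[OF assms, where Q = "\<lambda>ws w. length w = f + g \<and> set ws \<subseteq> {1..<f + g}"])
      auto
  then show ?thesis ..
qed

text \<open>Each generator of \<open>tword\<close> meets a pair AB, so \<open>s_op_AB\<close> alone
  governs the whole product.\<close>

lemma s_op_tword:
  assumes "ls \<in> Pfg f g" "length w = f + g"
  shows "foldr s_op (tword f g ls) (coeff [] (replicate f A @ replicate g B)) w = coeff [] (word_of f ls) w"
proof -
  let ?Q = "\<lambda>ws v. length v = f + g \<and>
    (\<forall>w. length w = f + g \<longrightarrow> foldr s_op ws (coeff [] (replicate f A @ replicate g B)) w = coeff [] v w)"
  have "?Q (tword f g ls) (word_of f ls)"
  proof (rule tword_induct[OF assms(1), where Q = ?Q])
    fix ws x y assume Q: "?Q ws (x @ A # B # y)"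
    have "foldr s_op (Suc (length x) # ws) (coeff [] (replicate f A @ replicate g B)) w
        = coeff [] (x @ B # A # y) w" if "length w = f + g" for w
    proof -
      have "foldr s_op (Suc (length x) # ws) (coeff [] (replicate f A @ replicate g B)) w
         = s_op (Suc (length x)) (coeff [] (x @ A # B # y)) w"
        using Q that by (simp add: s_op_def)
      then show ?thesis using s_op_AB[of w x y] Q that by simp
    qed
    then show "?Q (Suc (length x) # ws) (x @ B # A # y)" using Q by auto
  qed simp
  then show ?thesis using assms(2) by blast
qed

section \<open>Vectors fixed by the Young subgroup\<close>

context
  fixes scale :: "'a::field \<Rightarrow> 'b::ab_group_add \<Rightarrow> 'b"
    and act :: "(nat \<Rightarrow> nat) \<Rightarrow> 'b \<Rightarrow> 'b"
    and m :: 'b and f g :: nat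
  assumes Sk: "Sk_module scale (f + g) act"
    and fixed: "\<forall>i. 1 \<le> i \<and> i < f + g \<and> i \<noteq> f \<longrightarrow> act (tgen i) m = m"
begin

interpretation module scale
  using Sk by (simp add: Sk_module_def)

lemma act_comp:
  "\<sigma> permutes {1..f + g} \<Longrightarrow> \<tau> permutes {1..f + g} \<Longrightarrow> act (\<sigma> \<circ> \<tau>) v = act \<sigma> (act \<tau> v)"
  using Sk by (simp add: Sk_module_def)

lemma act_id: "act id v = v"
  using Sk by (simp add: Sk_module_def)

lemma act_hom: "\<sigma> permutes {1..f + g} \<Longrightarrow> module_hom scale scale (act \<sigma>)"
  using Sk by (simp add: Sk_module_def)

lemma tgen_permutes: "1 \<le> i \<Longrightarrow> i < f + g \<Longrightarrow> tgen i permutes {1..f + g}"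
  unfolding tgen_def by (rule permutes_swap_id) auto

lemma act_transpose:
  assumes "1 \<le> a" "a < b" "b \<le> f + g" "\<And>i. a \<le> i \<Longrightarrow> i < b \<Longrightarrow> i \<noteq> f"
  shows "act (transpose a b) m = m"
  using assms(2-4)
proof (induction b)
  case 0
  then show ?case by simp
next
  case (Suc b)
  have t: "tgen b permutes {1..f + g}" by (rule tgen_permutes) (use Suc.prems assms(1) in auto)
  have tm: "act (tgen b) m = m" using Suc.prems assms(1) fixed by auto
  show ?case
  proof (cases "a = b")
    case True
    then show ?thesis using tm by (simp add: tgen_def)
  next
    case False
    then have "a < b" using Suc.prems(1) by simp
    then have ab: "transpose a b permutes {1..f + g}"
      using assms(1) Suc.prems(2) by (intro permutes_swap_id) auto
    have "transpose a (Suc b) = tgen b \<circ> (transpose a b \<circ> tgen b)"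
      using \<open>a < b\<close> by (auto simp: fun_eq_iff tgen_def transpose_def)
    moreover have "act (transpose a b) m = m" using Suc \<open>a < b\<close> by simp
    ultimately show ?thesis
      using act_comp[OF t permutes_compose[OF t ab]] act_comp[OF ab t] tm by metis
  qed
qed

lemma act_block:
  assumes "\<sigma> permutes S" "S = {1..f} \<or> S = {f + 1..f + g}"
  shows "act \<sigma> m = m"
proof -
  have fin: "finite S" and sub: "S \<subseteq> {1..f + g}" using assms(2) by auto
  have tr: "act (transpose a b) m = m" if "a \<in> S" "b \<in> S" "a < b" for a b
    using that assms(2) by (intro act_transpose) auto
  show ?thesis using assms(1) fin
  proof (induction rule: permutes_induct)
    case id
    then show ?case by (rule act_id)
  next
    case (swap a b p)
    have "act (transpose a b) m = m"
      using tr[of a b] tr[of b a] swap by (metis linorder_neqE_nat transpose_commute)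
    moreover have "transpose a b permutes {1..f + g}" "p permutes {1..f + g}"
      using swap sub permutes_subset by (auto intro!: permutes_swap_id)
    ultimately show ?case using swap by (metis act_comp)
  qed
qed

text \<open>Such a permutation is the product of its restrictions to the two blocks, and each block
  group is generated by transpositions that fix \<open>m\<close>.\<close>

lemma act_stabilizer:
  assumes "\<sigma> permutes {1..f + g}" "\<And>i. i \<in> {1..f + g} \<Longrightarrow> \<sigma> i \<le> f \<longleftrightarrow> i \<le> f"
  shows "act \<sigma> m = m"
proof -
  have part: "(\<lambda>i. if i \<in> S then \<sigma> i else i) permutes S" if "finite S" "\<sigma> ` S \<subseteq> S" for S
  proof (rule bij_imp_permutes)
    have "inj_on \<sigma> S" using permutes_inj[OF assms(1)] by (rule inj_on_subset) simp
    then have "bij_betw \<sigma> S S" using endo_inj_surj[OF that] by (simp add: bij_betw_def)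
    then show "bij_betw (\<lambda>i. if i \<in> S then \<sigma> i else i) S S"
      by (rule bij_betw_cong[THEN iffD1, rotated]) simp
  qed simp
  have rng: "\<sigma> i \<in> {1..f + g}" if "i \<in> {1..f + g}" for i
    using permutes_in_image[OF assms(1)] that by blast
  let ?p = "\<lambda>i. if i \<in> {1..f} then \<sigma> i else i" and ?q = "\<lambda>i. if i \<in> {f + 1..f + g} then \<sigma> i else i"
  have p: "?p permutes {1..f}" by (rule part) (use rng assms(2) in fastforce)+
  have q: "?q permutes {f + 1..f + g}"
  proof (rule part)
    show "\<sigma> ` {f + 1..f + g} \<subseteq> {f + 1..f + g}"
    proof
      fix j assume "j \<in> \<sigma> ` {f + 1..f + g}"
      then obtain i where "j = \<sigma> i" "i \<in> {f + 1..f + g}" by blast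
      then show "j \<in> {f + 1..f + g}" using rng[of i] assms(2)[of i] by auto
    qed
  qed simp
  have "\<sigma> = ?p \<circ> ?q"
  proof
    fix i
    consider "i \<in> {1..f}" | "i \<in> {f + 1..f + g}" | "i \<notin> {1..f + g}" by fastforce
    then show "\<sigma> i = (?p \<circ> ?q) i"
    proof cases
      case 2
      then have "\<not> \<sigma> i \<le> f" using assms(2)[of i] by auto
      then show ?thesis using 2 by simp
    next
      case 3
      then have "\<sigma> i = i" by (rule permutes_not_in[OF assms(1)])
      then show ?thesis using 3 by auto
    qed auto
  qed
  then have "act \<sigma> m = act (?p \<circ> ?q) m" by (rule arg_cong[where f = "\<lambda>\<tau>. act \<tau> m"])
  also have "\<dots> = act ?p (act ?q m)"
  proof (rule act_comp)
    show "?p permutes {1..f + g}" by (rule permutes_subset[OF p]) auto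
    show "?q permutes {1..f + g}" by (rule permutes_subset[OF q]) auto
  qed
  also have "act ?q m = m" by (rule act_block[OF q]) simp
  also have "act ?p m = m" by (rule act_block[OF p]) simp
  finally show ?thesis .
qed

section \<open>Vectors indexed by words\<close>

definition carries :: "(nat \<Rightarrow> nat) \<Rightarrow> letter list \<Rightarrow> bool" where
  "carries \<sigma> w \<longleftrightarrow> \<sigma> permutes {1..f + g} \<and>
     (\<forall>i\<in>{1..f + g}. w ! (\<sigma> i - 1) = (if i \<le> f then A else B))"

text \<open>The permutations carrying the initial word to \<open>w\<close> form a coset of the Young
  subgroup: two of them differ on the right by a permutation preserving the blocks, which fixes
  \<open>m\<close>.\<close>

lemma carries_unique:
  assumes "carries \<sigma> w" "carries \<tau> w"
  shows "act \<sigma> m = act \<tau> m"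
proof -
  have p: "\<sigma> permutes {1..f + g}" "\<tau> permutes {1..f + g}" using assms by (auto simp: carries_def)
  define \<rho> where "\<rho> = inv \<tau> \<circ> \<sigma>"
  have \<rho>: "\<rho> permutes {1..f + g}" unfolding \<rho>_def using p by (intro permutes_compose permutes_inv)
  have eq: "\<tau> (\<rho> i) = \<sigma> i" for i unfolding \<rho>_def using permutes_inverses(1)[OF p(2)] by simp
  have "\<rho> i \<le> f \<longleftrightarrow> i \<le> f" if "i \<in> {1..f + g}" for i
  proof -
    have "\<rho> i \<in> {1..f + g}" using permutes_in_image[OF \<rho>] that by blast
    then have "(if \<rho> i \<le> f then A else B) = (if i \<le> f then A else B)"
      using assms that eq[of i] unfolding carries_def by metis
    then show ?thesis by (auto split: if_splits)
  qed
  then have "act \<rho> m = m" using act_stabilizer[OF \<rho>] by blast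
  moreover have "\<sigma> = \<tau> \<circ> \<rho>" using eq by auto
  ultimately show ?thesis using act_comp[OF p(2) \<rho>] by metis
qed

lemma carries_swap:
  assumes "carries \<sigma> w" "length w = f + g" "1 \<le> i" "i < f + g"
  shows "carries (tgen i \<circ> \<sigma>) (swap i w)"
proof -
  have p: "\<sigma> permutes {1..f + g}" using assms(1) by (simp add: carries_def)
  have "swap i w ! (tgen i (\<sigma> j) - 1) = w ! (\<sigma> j - 1)" if "j \<in> {1..f + g}" for j
    using nth_swap_tgen[of i w "\<sigma> j"] permutes_in_image[OF p, of j] that assms by simp
  then show ?thesis
    using assms(1) permutes_compose[OF p tgen_permutes[OF assms(3,4)]] by (simp add: carries_def)
qed

definition vec :: "letter list \<Rightarrow> 'b" where
  "vec w = act (SOME \<sigma>. carries \<sigma> w) m"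

lemma vec_carries: "carries \<sigma> w \<Longrightarrow> vec w = act \<sigma> m"
  unfolding vec_def using carries_unique someI[of "\<lambda>\<sigma>. carries \<sigma> w"] by blast

text \<open>Since every word comes from a partition, this also supplies a carrying permutation for
  each word, so the choice in \<open>vec\<close> is never void.\<close>

lemma t_act_tword:
  assumes "ls \<in> Pfg f g"
  shows "\<exists>\<sigma>. carries \<sigma> (word_of f ls) \<and> t_act act (tword f g ls) m = act \<sigma> m"
proof -
  let ?Q = "\<lambda>ws w. length w = f + g \<and> (\<exists>\<sigma>. carries \<sigma> w \<and> t_act act ws m = act \<sigma> m)"
  have "?Q (tword f g ls) (word_of f ls)"
  proof (rule tword_induct[OF assms, where Q = ?Q])
    have "carries id (replicate f A @ replicate g B)"
      by (auto simp: carries_def nth_append permutes_id)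
    then show "?Q [] (replicate f A @ replicate g B)" by (auto simp: t_act_def act_id intro!: exI[of _ id])
  next
    fix ws x y assume Q: "?Q ws (x @ A # B # y)"
    then obtain \<sigma> where \<sigma>: "carries \<sigma> (x @ A # B # y)" "t_act act ws m = act \<sigma> m" by blast
    have i: "1 \<le> Suc (length x)" "Suc (length x) < f + g" using Q by auto
    have "carries (tgen (Suc (length x)) \<circ> \<sigma>) (x @ B # A # y)"
      using carries_swap[OF \<sigma>(1) _ i] Q swap_append[of x A B y] by simp
    moreover have "t_act act (Suc (length x) # ws) m = act (tgen (Suc (length x)) \<circ> \<sigma>) m"
      using \<sigma> act_comp[OF tgen_permutes[OF i]] by (simp add: t_act_def carries_def)
    ultimately show "?Q (Suc (length x) # ws) (x @ B # A # y)" using Q by auto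
  qed
  then show ?thesis by blast
qed

lemma vec_word_of: "ls \<in> Pfg f g \<Longrightarrow> t_act act (tword f g ls) m = vec (word_of f ls)"
  using t_act_tword vec_carries by metis

lemma act_vec:
  assumes "w \<in> words f g" "1 \<le> i" "i < f + g"
  shows "act (tgen i) (vec w) = vec (swap i w)"
proof -
  obtain ls where "ls \<in> Pfg f g" "w = word_of f ls"
    using assms(1) bij_betw_imp_surj_on[OF word_of_bij[of f g]] by blast
  then obtain \<sigma> where \<sigma>: "carries \<sigma> w" using t_act_tword by blast
  have "vec (swap i w) = act (tgen i \<circ> \<sigma>) m"
    using vec_carries[OF carries_swap[OF \<sigma> length_words[OF assms(1)] assms(2,3)]] .
  then show ?thesis
    using vec_carries[OF \<sigma>] act_comp[OF tgen_permutes[OF assms(2,3)]] \<sigma> by (simp add: carries_def)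
qed

definition realize :: "(letter list \<Rightarrow> int) \<Rightarrow> 'b" where
  "realize \<phi> = (\<Sum>w\<in>words f g. scale (of_int (\<phi> w)) (vec w))"

text \<open>The swap is an involution on the words, so reindexing moves it from the vectors to the
  coefficient function. Thus \<open>realize\<close> intertwines \<open>s_op\<close> with the
  action.\<close>

lemma act_realize:
  assumes "1 \<le> i" "i < f + g"
  shows "act (tgen i) (realize \<phi>) - realize \<phi> = realize (s_op i \<phi>)"
proof -
  interpret h: module_hom scale scale "act (tgen i)"
    by (rule act_hom[OF tgen_permutes[OF assms]])
  have "act (tgen i) (realize \<phi>) = (\<Sum>w\<in>words f g. scale (of_int (\<phi> w)) (vec (swap i w)))"
    unfolding realize_def h.sum h.scale using act_vec assms by (intro sum.cong) auto
  also have "\<dots> = (\<Sum>w\<in>words f g. scale (of_int (\<phi> (swap i w))) (vec w))"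
    by (rule sum.reindex_bij_witness[of _ "swap i" "swap i"]) (use swap_words assms in auto)
  finally show ?thesis
    by (simp add: realize_def s_op_def scale_left_diff_distrib sum_subtractf)
qed

lemma s_act_realize:
  "set ws \<subseteq> {1..<f + g} \<Longrightarrow> s_act act ws (realize \<phi>) = realize (foldr s_op ws \<phi>)"
  by (induction ws) (auto simp: s_act_def act_realize)

lemma realize_cong:
  "(\<And>w. w \<in> words f g \<Longrightarrow> \<phi> w = \<psi> w) \<Longrightarrow> realize \<phi> = realize \<psi>"
  unfolding realize_def by (intro sum.cong) auto

lemma realize_bottom: "realize (coeff [] (replicate f A @ replicate g B)) = m"
proof -
  let ?b = "replicate f A @ replicate g B"
  have "?b \<in> words f g" by (simp add: words_def)
  have "carries id ?b" by (auto simp: carries_def nth_append permutes_id)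
  then have "vec ?b = m" using vec_carries act_id by metis
  have "realize (coeff [] ?b) = (\<Sum>w\<in>words f g. if w = ?b then vec ?b else 0)"
    unfolding realize_def using coeff_bottom_word length_words by (intro sum.cong) auto
  also have "\<dots> = m" using \<open>?b \<in> words f g\<close> \<open>vec ?b = m\<close> finite_words by simp
  finally show ?thesis .
qed

lemma s_act_tword:
  assumes "ls \<in> Pfg f g"
  shows "s_act act (tword f g ls) m = realize (coeff [] (word_of f ls))"
proof -
  have "s_act act (tword f g ls) m
    = realize (foldr s_op (tword f g ls) (coeff [] (replicate f A @ replicate g B)))"
    using s_act_realize[OF tword_letters[OF assms]] realize_bottom by metis
  also have "\<dots> = realize (coeff [] (word_of f ls))"
    using s_op_tword[OF assms] length_words by (intro realize_cong) blast
  finally show ?thesis .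
qed

lemma sum_t_act_eq_sum_s_act:
  "(\<Sum>mu\<in>Pfg f g. t_act act (tword f g mu) m)
    = (\<Sum>lam\<in>Pfg f g. scale (of_nat (Fpart lam)) (s_act act (tword f g lam) m))"
proof -
  have "(\<Sum>lam\<in>Pfg f g. scale (of_nat (Fpart lam)) (s_act act (tword f g lam) m))
    = (\<Sum>lam\<in>Pfg f g. \<Sum>w\<in>words f g.
        scale (of_int (int (Fpart lam) * coeff [] (word_of f lam) w)) (vec w))"
    by (intro sum.cong) (auto simp: s_act_tword realize_def scale_sum_right)
  also have "\<dots> = (\<Sum>w\<in>words f g.
      scale (of_int (\<Sum>lam\<in>Pfg f g. int (Fpart lam) * coeff [] (word_of f lam) w)) (vec w))"
    by (subst sum.swap) (simp only: of_int_sum scale_sum_left)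
  also have "\<dots> = (\<Sum>w\<in>words f g. vec w)"
    by (intro sum.cong) (auto simp: sum_Fpart_coeff)
  also have "\<dots> = (\<Sum>mu\<in>Pfg f g. vec (word_of f mu))"
    by (rule sum.reindex_bij_betw[OF word_of_bij, symmetric])
  also have "\<dots> = (\<Sum>mu\<in>Pfg f g. t_act act (tword f g mu) m)"
    by (intro sum.cong) (auto simp: vec_word_of)
  finally show ?thesis ..
qed

end

theorem theorem5p12:
  fixes scale :: "'a::field \<Rightarrow> 'b::ab_group_add \<Rightarrow> 'b"
    and act :: "(nat \<Rightarrow> nat) \<Rightarrow> 'b \<Rightarrow> 'b"
    and m :: 'b and f g :: nat
  assumes "Sk_module scale (f + g) act"
    and "\<forall>i. 1 \<le> i \<and> i < f + g \<and> i \<noteq> f \<longrightarrow> act (tgen i) m = m"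
  shows "(\<Sum>mu\<in>Pfg f g. t_act act (tword f g mu) m)
       = (\<Sum>lam\<in>Pfg f g. scale (of_nat (Fpart lam)) (s_act act (tword f g lam) m))"
  by (rule sum_t_act_eq_sum_s_act[OF assms])

end
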